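(* Let $G$ be a plane graph and let $A\subseteq E(G)$, with complement $A^c=E(G)\setminus A$. Then: (1) the partial dual $G^A$ is bipartite if and only if the components of $G|_{A}$ and of $G^*|_{A^c}$ are Eulerian; (2) the partial dual $G^A$ is Eulerian if and only if $G|_{A}$ and $G^*|_{A^c}$ are bipartite.
   Context: Graphs are finite and may have loops and multiple edges. A connected graph is Eulerian if it has a closed trail using every edge exactly once, equivalently if every vertex has even degree (loops count twice). A graph is bipartite if it is $2$-colourable. An embedded graph is a graph drawn on a surface with edges meeting only at their ends; it is cellularly embedded if every region (component of the complement) is an open disc, and the regions are then called faces. A plane graph is a graph cellularly embedded in the sphere (hence connected). Properties such as bipartite or Eulerian of an embedded graph refer to its underlying abstract graph. A ribbon graph $G=(V(G),E(G))$ is a (possibly non-orientable) surface with boundary, represented as the union of a set $V(G)$ of discs (vertices) and a set $E(G)$ of discs (edges) such that vertices and edges meet in disjoint line segments, each such segment lies on the boundary of exactly one vertex and exactly one edge, and every edge contains exactly two such segments. Ribbon graphs are equivalent to cellularly embedded graphs (take a neighbourhood of the embedded graph; conversely, glue discs to the boundary components), and one moves freely between them. Geometric dual: for a ribbon graph $G$, fill each boundary component of $G$ with a disc; calling the set of these discs $V(G^* )$, the dual is $G^*=(V(G^* ),E(G))$. For cellularly embedded graphs this is the usual geometric dual. $E(G)$ and $E(G^* )$ are identified in the natural way. $G|_A$ is the ribbon subgraph induced by $A$: its edge set is $A$ and its vertices are the vertices of $G$ incident with an edge in $A$. Similarly, $G^*|_{A^c}$ is the subgraph of $G^*$ induced by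 the edges corresponding to $A^c$. Partial dual: an arrow-marked ribbon graph is a ribbon graph with coloured arrows on the boundaries of its vertices, disjoint from the edges, with exactly two arrows of each colour. For $B\subseteq E(G)$, $G\,\vec{-}\,B$ is the arrow-marked ribbon graph obtained by, for each $e\in B$, orienting the boundary of $e$ arbitrarily, placing on each of the two arcs where $e$ meets vertices an arrow coloured $e$ following this orientation, and deleting $e$. Conversely, if $H$ is an arrow-marked ribbon graph with label set $B$, then $H\,\vec{+}\,B$ is the ribbon graph obtained by, for each $e\in B$, taking a disc with oriented boundary and identifying two disjoint arcs of its boundary with the two arrows coloured $e$ consistently with the orientation; the disc becomes an edge $e$. The geometric dual of an arrow-marked ribbon graph is the geometric dual of the underlying ribbon graph with the marking arrows it inherits (the boundaries of the vertices of the ribbon graph and of those of its dual intersect, and the arrows lie on the intersection). The partial dual of $G$ with respect to $A$ is $G^A:=(G\,\vec{-}\,A^c)^*\,\vec{+}\,A^c$. *)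

theory Defs
  imports "HOL-Analysis.Analysis" "HOL-Library.Multiset"
begin

section \<open>Abstract graphs\<close>

text \<open>
  Finite graphs with loops and multiple edges. The multiset \<open>ends g e\<close> has two elements;
  for a loop at \<open>v\<close> it is \<open>{#v, v#}\<close>.
\<close>

record ('v, 'e) multigraph =
  mverts :: "'v set"
  medges :: "'e set"
  ends :: "'e \<Rightarrow> 'v multiset"

fun walk :: "('v, 'e) multigraph \<Rightarrow> 'v \<Rightarrow> 'e list \<Rightarrow> 'v \<Rightarrow> bool" where
  "walk g u [] v \<longleftrightarrow> u \<in> mverts g \<and> u = v"
| "walk g u (e # es) v \<longleftrightarrow>
     u \<in> mverts g \<and> e \<in> medges g \<and> (\<exists>w. ends g e = {#u, w#} \<and> walk g w es v)"

definition mconnected :: "('v, 'e) multigraph \<Rightarrow> bool" where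
  "mconnected g \<longleftrightarrow> mverts g \<noteq> {} \<and> (\<forall>u\<in>mverts g. \<forall>v\<in>mverts g. \<exists>es. walk g u es v)"

definition eulerian :: "('v, 'e) multigraph \<Rightarrow> bool" where
  "eulerian g \<longleftrightarrow> mconnected g \<and> (\<exists>u es. walk g u es u \<and> distinct es \<and> set es = medges g)"

definition bipartite :: "('v, 'e) multigraph \<Rightarrow> bool" where
  "bipartite g \<longleftrightarrow>
     (\<exists>c :: 'v \<Rightarrow> bool. \<forall>e\<in>medges g. \<forall>u v. ends g e = {#u, v#} \<longrightarrow> c u \<noteq> c v)"

definition edge_induced :: "('v, 'e) multigraph \<Rightarrow> 'e set \<Rightarrow> ('v, 'e) multigraph" where
  "edge_induced g A =
     \<lparr>mverts = {v \<in> mverts g. \<exists>e\<in>A. v \<in># ends g e}, medges = A, ends = ends g\<rparr>"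

definition mcomponent :: "('v, 'e) multigraph \<Rightarrow> 'v \<Rightarrow> ('v, 'e) multigraph" where
  "mcomponent g u =
     (let W = {v. \<exists>es. walk g u es v}
      in \<lparr>mverts = W, medges = {e \<in> medges g. set_mset (ends g e) \<subseteq> W}, ends = ends g\<rparr>)"

definition mcomponents :: "('v, 'e) multigraph \<Rightarrow> ('v, 'e) multigraph set" where
  "mcomponents g = mcomponent g ` mverts g"


section \<open>Arrow-marked ribbon graphs\<close>

text \<open>
  An arrow-marked ribbon graph is encoded by its gluing data. On the boundary circles of the
  vertex discs lie disjoint arcs: the segments where an edge disc meets a vertex, and the
  marking arrows. The \<^emph>\<open>flags\<close> are the end points of these arcs.

  \<^item> \<open>arc_map\<close> sends a flag to the other end of its arc;
  \<^item> \<open>corner_map\<close> sends a flag \<open>x\<close> to the other end of the piece of the vertex boundary that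
    starts at \<open>x\<close>, lies outside all arcs and runs to the next arc (possibly the same arc);
  \<^item> \<open>side_map\<close>, relevant only for flags on edges, sends a flag to the other end of the free side
    of its edge disc, i.e. of the part of the boundary of the edge disc that does not lie on a
    vertex.

  Every edge and every colour owns two arcs, hence four flags. A marking arrow points towards the
  end of its arc that belongs to \<open>heads\<close>. Vertex discs that carry no arc at all have no flags;
  they are recorded in \<open>bare\<close>.
\<close>

record ('f, 'e, 'd) arrow_ribbon =
  flags :: "'f set"
  bare :: "'d set"
  edges :: "'e set"
  colours :: "'e set"
  label :: "'f \<Rightarrow> 'e"
  corner_map :: "'f \<Rightarrow> 'f"
  arc_map :: "'f \<Rightarrow> 'f"
  side_map :: "'f \<Rightarrow> 'f"
  heads :: "'f set"

definition pairing_on :: "'f set \<Rightarrow> ('f \<Rightarrow> 'f) \<Rightarrow> bool" where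
  "pairing_on S t \<longleftrightarrow> (\<forall>x\<in>S. t x \<in> S \<and> t x \<noteq> x \<and> t (t x) = x)"

definition arrow_ribbon_graph :: "('f, 'e, 'd) arrow_ribbon \<Rightarrow> bool" where
  "arrow_ribbon_graph G \<longleftrightarrow>
     finite (flags G) \<and> finite (bare G) \<and>
     edges G \<inter> colours G = {} \<and>
     label G ` flags G \<subseteq> edges G \<union> colours G \<and>
     (\<forall>e \<in> edges G \<union> colours G. card {x \<in> flags G. label G x = e} = 4) \<and>
     pairing_on (flags G) (corner_map G) \<and>
     pairing_on (flags G) (arc_map G) \<and>
     (\<forall>x \<in> flags G. label G (arc_map G x) = label G x) \<and>
     pairing_on {x \<in> flags G. label G x \<in> edges G} (side_map G) \<and>
     (\<forall>x \<in> flags G. label G x \<in> edges G \<longrightarrow>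
        label G (side_map G x) = label G x \<and> side_map G x \<noteq> arc_map G x) \<and>
     heads G \<subseteq> {x \<in> flags G. label G x \<in> colours G} \<and>
     (\<forall>x \<in> flags G. label G x \<in> colours G \<longrightarrow> (arc_map G x \<in> heads G \<longleftrightarrow> x \<notin> heads G))"

definition ribbon_graph :: "('f, 'e, 'd) arrow_ribbon \<Rightarrow> bool" where
  "ribbon_graph G \<longleftrightarrow> arrow_ribbon_graph G \<and> colours G = {}"

definition orbit_under :: "('f \<Rightarrow> 'f) set \<Rightarrow> 'f \<Rightarrow> 'f set" where
  "orbit_under T x = {y. (x, y) \<in> {(z, t z) | t z. t \<in> T}\<^sup>*}"

text \<open>
  Running along the boundary of a vertex disc one meets arcs and corners alternately, so a vertex
  that carries an arc is given by the set of flags on its boundary.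
\<close>

definition vertex_at :: "('f, 'e, 'd) arrow_ribbon \<Rightarrow> 'f \<Rightarrow> 'f set + 'd" where
  "vertex_at G x = Inl (orbit_under {corner_map G, arc_map G} x)"

definition vertices :: "('f, 'e, 'd) arrow_ribbon \<Rightarrow> ('f set + 'd) set" where
  "vertices G = vertex_at G ` flags G \<union> Inr ` bare G"

definition arcs_of :: "('f, 'e, 'd) arrow_ribbon \<Rightarrow> 'e \<Rightarrow> 'f set set" where
  "arcs_of G e = (\<lambda>x. {x, arc_map G x}) ` {x \<in> flags G. label G x = e}"

text \<open>
  The two ends of an edge are the vertices that carry its two arcs; both flags of an arc lie on
  the same vertex, so \<open>vertex_at G ` a\<close> is a singleton.
\<close>

definition underlying :: "('f, 'e, 'd) arrow_ribbon \<Rightarrow> ('f set + 'd, 'e) multigraph" where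
  "underlying G =
     \<lparr>mverts = vertices G, medges = edges G,
      ends = (\<lambda>e. image_mset (\<lambda>a. the_elem (vertex_at G ` a)) (mset_set (arcs_of G e)))\<rparr>"


section \<open>Duals and partial duals\<close>

text \<open>
  A boundary component of the surface runs alternately along corners and along either the free
  side of an edge or a marking arrow (a bare vertex disc has one boundary component, without
  flags). The disc filled in there is a vertex of the dual; it meets the edge discs in what were
  their free sides, and the old arcs of the edges become free sides.
\<close>

definition dual :: "('f, 'e, 'd) arrow_ribbon \<Rightarrow> ('f, 'e, 'd) arrow_ribbon" where
  "dual G = G\<lparr>
     arc_map := (\<lambda>x. if label G x \<in> edges G then side_map G x else arc_map G x),
     side_map := (\<lambda>x. if label G x \<in> edges G then arc_map G x else side_map G x)\<rparr>"

text \<open>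
  The boundary of an edge disc is a 4-cycle of flags, alternately joined by arcs and free sides.
  An orientation of this boundary for every \<open>e \<in> B\<close> is encoded by the set \<open>H\<close> of those flags at
  which the oriented boundary leaves an arc (and enters a free side).
\<close>

definition boundary_orientation ::
    "('f, 'e, 'd) arrow_ribbon \<Rightarrow> 'e set \<Rightarrow> 'f set \<Rightarrow> bool" where
  "boundary_orientation G B H \<longleftrightarrow>
     H \<subseteq> {x \<in> flags G. label G x \<in> B} \<and>
     (\<forall>x \<in> flags G. label G x \<in> B \<longrightarrow>
        (arc_map G x \<in> H \<longleftrightarrow> x \<notin> H) \<and> (side_map G x \<in> H \<longleftrightarrow> x \<notin> H))"

text \<open>
  Replacing the edges in \<open>B\<close> by arrows that follow the orientation \<open>H\<close>. The information how the
  free sides of the deleted edges ran is discarded.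
\<close>

definition delete_to_arrows ::
    "('f, 'e, 'd) arrow_ribbon \<Rightarrow> 'e set \<Rightarrow> 'f set \<Rightarrow> ('f, 'e, 'd) arrow_ribbon" where
  "delete_to_arrows G B H = G\<lparr>
     edges := edges G - B,
     colours := colours G \<union> B,
     side_map := (\<lambda>x. if label G x \<in> B then x else side_map G x),
     heads := heads G \<union> H\<rparr>"

text \<open>
  Gluing in an edge disc for every colour in \<open>B\<close>: its oriented boundary follows one arrow, then
  runs along a free side from the head of this arrow to the tail of the other arrow of the same
  colour, follows that arrow, and returns from its head to the tail of the first arrow.
\<close>

definition arrows_to_edges ::
    "('f, 'e, 'd) arrow_ribbon \<Rightarrow> 'e set \<Rightarrow> ('f, 'e, 'd) arrow_ribbon" where
  "arrows_to_edges G B = G\<lparr>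
     edges := edges G \<union> B,
     colours := colours G - B,
     side_map := (\<lambda>x. if label G x \<in> B
       then (THE y. y \<in> flags G \<and> label G y = label G x \<and> y \<notin> {x, arc_map G x} \<and>
                    (y \<in> heads G \<longleftrightarrow> x \<notin> heads G))
       else side_map G x),
     heads := heads G - {x. label G x \<in> B}\<rparr>"

definition partial_dual ::
    "('f, 'e, 'd) arrow_ribbon \<Rightarrow> 'e set \<Rightarrow> 'f set \<Rightarrow> ('f, 'e, 'd) arrow_ribbon" where
  "partial_dual G A H =
     arrows_to_edges (dual (delete_to_arrows G (edges G - A) H)) (edges G - A)"


subsection \<open>Consistency of the definitions\<close>

lemma ribbon_graph_flagD:
  assumes "ribbon_graph G" "x \<in> flags G"
  shows "label G x \<in> edges G"
    and "arc_map G x \<in> flags G" "arc_map G x \<noteq> x" "arc_map G (arc_map G x) = x"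
    and "corner_map G x \<in> flags G" "corner_map G x \<noteq> x" "corner_map G (corner_map G x) = x"
    and "side_map G x \<in> flags G" "side_map G x \<noteq> x" "side_map G (side_map G x) = x"
    and "label G (arc_map G x) = label G x" "label G (side_map G x) = label G x"
    and "side_map G x \<noteq> arc_map G x"
    and "card {y \<in> flags G. label G y = label G x} = 4"
proof -
  have l: "label G x \<in> edges G"
    using assms by (auto simp: ribbon_graph_def arrow_ribbon_graph_def)
  show "label G x \<in> edges G"
    and "arc_map G x \<in> flags G" "arc_map G x \<noteq> x" "arc_map G (arc_map G x) = x"
    and "corner_map G x \<in> flags G" "corner_map G x \<noteq> x" "corner_map G (corner_map G x) = x"
    and "side_map G x \<in> flags G" "side_map G x \<noteq> x" "side_map G (side_map G x) = x"
    and "label G (arc_map G x) = label G x" "label G (side_map G x) = label G x"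
    and "side_map G x \<noteq> arc_map G x"
    and "card {y \<in> flags G. label G y = label G x} = 4"
    using assms l by (simp_all add: ribbon_graph_def arrow_ribbon_graph_def pairing_on_def)
qed

lemma edge_flags:
  assumes "ribbon_graph G" "x \<in> flags G"
  shows "{y \<in> flags G. label G y = label G x}
           = {x, arc_map G x, side_map G x, arc_map G (side_map G x)}" (is "?L = ?R")
    and "arc_map G (side_map G x) \<notin> {x, arc_map G x, side_map G x}"
    and "side_map G (arc_map G x) = arc_map G (side_map G x)"
proof -
  note f = ribbon_graph_flagD[OF assms]
  note g = ribbon_graph_flagD[OF assms(1) f(8)]
  note h = ribbon_graph_flagD[OF assms(1) f(2)]
  show n: "arc_map G (side_map G x) \<notin> {x, arc_map G x, side_map G x}"
    using f g by auto
  have "card ?R = 4" using n f by auto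
  moreover have "?R \<subseteq> ?L" using assms f g by auto
  moreover have "finite ?L"
    using assms by (auto simp: ribbon_graph_def arrow_ribbon_graph_def)
  ultimately show e: "?L = ?R" using f(14) by (metis card_subset_eq)
  have "side_map G (arc_map G x) \<in> ?R"
    using h f by (auto simp flip: e)
  moreover have "side_map G (arc_map G x) \<noteq> side_map G x" using h f by metis
  moreover have "side_map G (arc_map G x) \<noteq> x" using h f by metis
  ultimately show "side_map G (arc_map G x) = arc_map G (side_map G x)"
    using h by auto
qed

lemma boundary_orientation_exists:
  assumes "ribbon_graph G" "B \<subseteq> edges G"
  shows "\<exists>H. boundary_orientation G B H"
proof -
  define r where "r e = (SOME x. x \<in> flags G \<and> label G x = e)" for e
  define H where "H = {x \<in> flags G. label G x \<in> B \<and>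
      (x = r (label G x) \<or> x = arc_map G (side_map G (r (label G x))))}"
  have "(arc_map G x \<in> H \<longleftrightarrow> x \<notin> H) \<and> (side_map G x \<in> H \<longleftrightarrow> x \<notin> H)"
    if x: "x \<in> flags G" "label G x \<in> B" for x
  proof -
    define y where "y = r (label G x)"
    have y: "y \<in> flags G" "label G y = label G x"
      unfolding y_def r_def using someI[of "\<lambda>z. z \<in> flags G \<and> label G z = label G x" x] x by auto
    note f = ribbon_graph_flagD[OF assms(1) x(1)]
    note g = ribbon_graph_flagD[OF assms(1) y(1)]
    note ex = edge_flags[OF assms(1) y(1)]
    have H: "z \<in> H \<longleftrightarrow> z = y \<or> z = arc_map G (side_map G y)"
      if "z \<in> flags G" "label G z = label G x" for z
      using that x by (auto simp: H_def y_def)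
    have "x \<in> {y, arc_map G y, side_map G y, arc_map G (side_map G y)}"
      using ex(1) x y by auto
    moreover note H[OF x(1) refl] H[OF f(2) f(11)] H[OF f(8) f(12)]
    moreover note ribbon_graph_flagD[OF assms(1) g(8)]
      ribbon_graph_flagD[OF assms(1) g(2)]
    ultimately show ?thesis using ex(2,3) g by auto
  qed
  then show ?thesis
    unfolding boundary_orientation_def by (intro exI[of _ H]) (auto simp: H_def)
qed

text \<open>In particular, the partial dual does not depend on the orientation.\<close>

lemma partial_dual_simps:
  assumes "ribbon_graph G" "A \<subseteq> edges G" "boundary_orientation G (edges G - A) H"
  shows "flags (partial_dual G A H) = flags G" "bare (partial_dual G A H) = bare G"
    and "edges (partial_dual G A H) = edges G" "colours (partial_dual G A H) = {}"
    and "heads (partial_dual G A H) = {}" "label (partial_dual G A H) = label G"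
    and "corner_map (partial_dual G A H) = corner_map G"
    and "x \<in> flags G \<Longrightarrow> arc_map (partial_dual G A H) x
           = (if label G x \<in> A then side_map G x else arc_map G x)"
    and "x \<in> flags G \<Longrightarrow> side_map (partial_dual G A H) x
           = (if label G x \<in> A then arc_map G x else side_map G x)"
proof -
  let ?P = "partial_dual G A H"
  note defs = partial_dual_def arrows_to_edges_def dual_def delete_to_arrows_def
  have [simp]: "colours G = {}" "heads G = {}"
    using assms(1) by (auto simp: ribbon_graph_def arrow_ribbon_graph_def)
  show "flags ?P = flags G" "bare ?P = bare G" "edges ?P = edges G" "colours ?P = {}"
    "heads ?P = {}" "label ?P = label G" "corner_map ?P = corner_map G"
    using assms(2,3) by (auto simp: defs boundary_orientation_def)
  assume x: "x \<in> flags G"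
  note f = ribbon_graph_flagD[OF assms(1) x]
  note ex = edge_flags[OF assms(1) x]
  show "arc_map ?P x = (if label G x \<in> A then side_map G x else arc_map G x)"
    using f assms(2) by (auto simp: defs)
  show "side_map ?P x = (if label G x \<in> A then arc_map G x else side_map G x)"
  proof (cases "label G x \<in> A")
    case True
    then show ?thesis using f assms(2) by (auto simp: defs)
  next
    case False
    note o = assms(3)[unfolded boundary_orientation_def, THEN conjunct2, rule_format]
    have hx: "side_map G x \<in> H \<longleftrightarrow> x \<notin> H" using o[OF x] f False by auto
    moreover have "arc_map G (side_map G x) \<in> H \<longleftrightarrow> x \<in> H"
      using o[OF f(8)] hx f False by auto
    ultimately have "(THE y. y \<in> flags G \<and> label G y = label G x \<and> y \<notin> {x, arc_map G x} \<and>
        (y \<in> H \<longleftrightarrow> x \<notin> H)) = side_map G x"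
      using ex(1) f by (intro the_equality) auto
    then show ?thesis using False f by (simp add: defs)
  qed
qed

lemma ribbon_graph_partial_dual:
  assumes "ribbon_graph G" "A \<subseteq> edges G" "boundary_orientation G (edges G - A) H"
  shows "ribbon_graph (partial_dual G A H)"
proof -
  note p = partial_dual_simps[OF assms]
  note f = ribbon_graph_flagD[OF assms(1)]
  have "finite (flags G)" "finite (bare G)" "label G ` flags G \<subseteq> edges G"
    "\<forall>e\<in>edges G. card {x \<in> flags G. label G x = e} = 4"
    using assms(1) by (auto simp: ribbon_graph_def arrow_ribbon_graph_def)
  then show ?thesis
    unfolding ribbon_graph_def arrow_ribbon_graph_def pairing_on_def p(1-7)
    using f by (auto simp: p(8,9)) (metis f(13))?
qed

lemma ribbon_graph_dual:
  assumes "ribbon_graph G"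
  shows "ribbon_graph (dual G)"
proof -
  note f = ribbon_graph_flagD[OF assms]
  have "finite (flags G)" "finite (bare G)" "label G ` flags G \<subseteq> edges G"
    "\<forall>e\<in>edges G. card {x \<in> flags G. label G x = e} = 4" "colours G = {}" "heads G = {}"
    using assms by (auto simp: ribbon_graph_def arrow_ribbon_graph_def)
  then show ?thesis
    unfolding ribbon_graph_def arrow_ribbon_graph_def pairing_on_def dual_def
    using f by auto (metis f(13))?
qed


section \<open>Plane graphs\<close>

text \<open>
  Filling the boundary components of a ribbon graph with discs gives a closed surface in which
  the core graph is cellularly embedded. Cut each face along segments from its centre to the
  vertices and to the midpoints of the edges on its boundary: this gives one triangle per flag,
  with corners at a vertex, at the midpoint of an edge and at the centre of a face. In
  barycentric coordinates \<open>(a, b, c)\<close> with respect to these corners, the triangle of \<open>x\<close> meets the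
  one of \<open>side_map G x\<close> in the side \<open>a = 0\<close>, the one of \<open>corner_map G x\<close> in the side \<open>b = 0\<close>, and
  the one of \<open>arc_map G x\<close> in the side \<open>c = 0\<close>.
\<close>

definition flag_triangle :: "(real \<times> real \<times> real) set" where
  "flag_triangle = {(a, b, c). 0 \<le> a \<and> 0 \<le> b \<and> 0 \<le> c \<and> a + b + c = 1}"

definition triangle_space :: "('f, 'e, 'd) arrow_ribbon \<Rightarrow> ('f \<times> real \<times> real \<times> real) topology" where
  "triangle_space G = prod_topology (discrete_topology (flags G)) (top_of_set flag_triangle)"

fun glued ::
    "('f, 'e, 'd) arrow_ribbon \<Rightarrow> 'f \<times> real \<times> real \<times> real \<Rightarrow> 'f \<times> real \<times> real \<times> real \<Rightarrow> bool" where
  "glued G (x, a, b, c) (y, q) \<longleftrightarrow>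
     q = (a, b, c) \<and>
     y \<in> orbit_under ((if a = 0 then {side_map G} else {}) \<union>
                      (if b = 0 then {corner_map G} else {}) \<union>
                      (if c = 0 then {arc_map G} else {})) x"

text \<open>
  A plane graph is a ribbon graph whose closed surface is the sphere, i.e. the sphere is the
  quotient of the flag triangles by the gluing. Without flags, the closed surface has one sphere
  component for each bare vertex disc.
\<close>

definition plane_graph :: "('f, 'e, 'd) arrow_ribbon \<Rightarrow> bool" where
  "plane_graph G \<longleftrightarrow> ribbon_graph G \<and>
     (flags G = {} \<and> card (bare G) = 1 \<or>
      bare G = {} \<and>
      (\<exists>p. quotient_map (triangle_space G) (top_of_set (sphere (0 :: real ^ 3) 1)) p \<and>
           (\<forall>z \<in> topspace (triangle_space G). \<forall>w \<in> topspace (triangle_space G).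
              p z = p w \<longleftrightarrow> glued G z w)))"

end

theory Submission
  imports Defs "HOL-Library.Z2"
begin

text \<open>
  Write \<open>c\<close>, \<open>a\<close>, \<open>s\<close> for the corner, arc and side involutions on flags, \<open>B\<close> for the complement of
  \<open>A\<close>, and \<open>t\<close> for the arc involution of the partial dual, which is \<open>s\<close> on the edges in \<open>A\<close> and \<open>a\<close> on
  those in \<open>B\<close>. Apart from bare discs, the vertices of \<open>G\<close>, of \<open>G*\<close> and of the partial dual are the
  orbits of \<open>c\<close> together with \<open>a\<close>, \<open>s\<close> and \<open>t\<close>, respectively. Every property in the theorem can be read off the flags:

  \<^item> bipartiteness is the existence of a two-colouring of the flags that is constant on vertices
    and changes along the free sides of the edges concerned (\<open>bipartite_edge_induced_iff\<close>);
  \<^item> by Euler's theorem, the components are Eulerian iff all degrees are even, which means that for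
    every union \<open>S\<close> of vertices the number of flags in \<open>S\<close> on the edges concerned is divisible by 4,
    since an arc has two flags (\<open>components_eulerian_iff_even_at_vertices\<close>).

  Planarity enters through connectedness and through the vanishing of the first cohomology of the
  sphere with coefficients in the field with two elements: a prescription of the pairs
  \<open>{x, c x}\<close>, \<open>{x, a x}\<close>, \<open>{x, s x}\<close> along which a two-colouring of the flags has to change can be met
  as soon as it can be met around each vertex, around each edge and around each face separately
  (\<open>plane_graph_cocycles_trivial\<close>). The proof turns three such local solutions into a map from the
  sphere to 3-space without the origin that is defined up to sign, and removes the ambiguity of sign
  by lifting through a double covering.

  For the first equivalence, a two-colouring witnessing that the partial dual is bipartite changes
  along \<open>a\<close> exactly on \<open>A\<close> and along \<open>s\<close> exactly on \<open>B\<close>. Around an edge this prescription is always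
  consistent; around a vertex it is consistent iff the vertex has even degree in \<open>A\<close>, and around a
  face iff the face has even degree in \<open>B\<close>.

  For the second one, if \<open>g\<close> and \<open>h\<close> are flag colourings for \<open>A\<close> in \<open>G\<close> and for \<open>B\<close> in \<open>G*\<close>, then
  their sum is invariant under \<open>c\<close> and changes at every step of \<open>t\<close>, so the vertices of the partial
  dual have even degree. Conversely, a colouring of \<open>G\<close> that changes along the free sides of \<open>A\<close> may do as it likes
  on \<open>B\<close>; by cohomology it suffices to solve the problem around the faces, with the constraint
  that both sides of an edge behave alike. This is a linear system over the field with two elements
  (\<open>two_partition_parity\<close>). Its obstructions are the flag sets \<open>S\<close> closed under \<open>c\<close>, \<open>s\<close> and, on \<open>B\<close>,
  \<open>a\<close>. Such an \<open>S\<close> is a union of vertices of the partial dual, so 4 divides its size; it contains the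
  edges in \<open>B\<close> entirely or not at all, so 4 also divides the number of its flags on \<open>A\<close>, and the
  obstruction vanishes.
\<close>

section \<open>The double covering given by the outer square of a vector\<close>

definition outer_square :: "real ^ 'n \<Rightarrow> real ^ 'n ^ 'n" where
  "outer_square u = (\<chi> i j. u $ i * u $ j)"

lemma continuous_on_outer_square: "continuous_on S outer_square"
  unfolding outer_square_def by (intro continuous_intros)

lemma outer_square_row: "outer_square u $ i = (u $ i) *\<^sub>R u"
  by (simp add: outer_square_def vec_eq_iff)

lemma outer_square_eqD:
  assumes "outer_square u = outer_square v"
  shows "u = v \<or> u = - v"
proof (cases "u = 0")
  case True
  have "v $ i * v $ i = 0" for i
    using arg_cong[OF assms, of "\<lambda>N. N $ i $ i"] True by (simp add: outer_square_def)
  then show ?thesis using True by (simp add: vec_eq_iff)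
next
  case False
  then obtain i where i: "u $ i \<noteq> 0" by (auto simp: vec_eq_iff)
  have "u $ i * u $ i = v $ i * v $ i"
    using assms by (auto simp: outer_square_def vec_eq_iff)
  then have dj: "u $ i = v $ i \<or> u $ i = - v $ i"
    by (metis square_eq_iff)
  have eq: "(u $ i) *\<^sub>R u = (v $ i) *\<^sub>R v"
    using arg_cong[OF assms, of "\<lambda>N. N $ i"] by (simp add: outer_square_row)
  from dj show ?thesis
  proof
    assume "u $ i = v $ i"
    then show ?thesis using eq i by simp
  next
    assume neg: "u $ i = - v $ i"
    then have "(v $ i) *\<^sub>R (- u) = (v $ i) *\<^sub>R v" using eq by simp
    then have "- u = v" using i neg by (simp only: scaleR_cancel_left) simp
    then show ?thesis by auto
  qed
qed

text \<open>
  The outer square determines a nonzero vector up to sign. Near the outer square of \<open>w\<close> with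
  \<open>w $ i \<noteq> 0\<close>, the sign of the \<open>i\<close>-th coordinate separates the two sheets, and row \<open>i\<close> of the
  matrix, divided by the square root of its diagonal entry, is a local section.
\<close>

lemma covering_space_outer_square:
  "covering_space (- {0} :: (real ^ 'n) set) outer_square (outer_square ` (- {0}))"
proof (rule covering_spaceI)
  let ?C = "- {0} :: (real ^ 'n) set"
  let ?S = "outer_square ` ?C"
  fix M assume "M \<in> ?S"
  then obtain w where w: "w \<noteq> 0" "M = outer_square w" by auto
  then obtain i where i: "w $ i \<noteq> 0" by (auto simp: vec_eq_iff)
  define T where "T = ?S \<inter> {N. N $ i $ i > 0}"
  define sh where "sh s = {u :: real ^ 'n. s * u $ i > 0}" for s
  have T: "M \<in> T" "openin (top_of_set ?S) T"
  proof -
    show "M \<in> T" using w i by (auto simp: T_def outer_square_def zero_less_mult_iff)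
    have "open {N :: real ^ 'n ^ 'n. N $ i $ i > 0}"
      by (intro open_Collect_less continuous_intros)
    then show "openin (top_of_set ?S) T" by (auto simp: T_def)
  qed
  have opn: "open (sh s)" for s
    unfolding sh_def by (intro open_Collect_less continuous_intros)
  have hom: "homeomorphism (sh s) T outer_square (\<lambda>N. (s / sqrt (N $ i $ i)) *\<^sub>R N $ i)"
    if s: "s = 1 \<or> s = -1" for s
  proof -
    have ii: "outer_square u $ i $ i = (u $ i)\<^sup>2" for u :: "real ^ 'n"
      by (simp add: outer_square_def power2_eq_square)
    have inv: "(s / sqrt (outer_square u $ i $ i)) *\<^sub>R outer_square u $ i = u"
      if "u \<in> sh s" for u
    proof -
      have "sqrt ((u $ i)\<^sup>2) = s * u $ i" "u $ i \<noteq> 0"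
        using that s by (auto simp: sh_def)
      then show ?thesis using s by (auto simp: ii outer_square_row)
    qed
    have pos: "outer_square u \<in> T" if "u \<in> sh s" for u
    proof -
      have "u $ i \<noteq> 0" "u \<noteq> 0" using that by (auto simp: sh_def)
      then show ?thesis by (auto simp: T_def outer_square_def zero_less_mult_iff)
    qed
    have onto: "\<exists>u \<in> sh s. N = outer_square u" if N: "N \<in> T" for N
    proof -
      obtain u where u: "N = outer_square u" "N $ i $ i > 0" using N by (auto simp: T_def)
      then have "u $ i \<noteq> 0" by (auto simp: outer_square_def)
      then have "u \<in> sh s \<or> - u \<in> sh s" using s by (auto simp: sh_def)
      moreover have "outer_square (- u) = outer_square u" by (simp add: outer_square_def)
      ultimately show ?thesis using u by metis
    qed
    show ?thesis
    proof (rule homeomorphismI)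
      show "continuous_on (sh s) outer_square" by (rule continuous_on_outer_square)
      show "continuous_on T (\<lambda>N. (s / sqrt (N $ i $ i)) *\<^sub>R N $ i)"
        by (intro continuous_intros) (auto simp: T_def)
      show "outer_square ` sh s \<subseteq> T" using pos by auto
      show "(\<lambda>N. (s / sqrt (N $ i $ i)) *\<^sub>R N $ i) ` T \<subseteq> sh s"
      proof (rule image_subsetI)
        fix N assume "N \<in> T"
        then obtain u where "u \<in> sh s" "N = outer_square u" using onto by blast
        then show "(s / sqrt (N $ i $ i)) *\<^sub>R N $ i \<in> sh s" using inv by simp
      qed
      show "(s / sqrt (outer_square u $ i $ i)) *\<^sub>R outer_square u $ i = u" if "u \<in> sh s" for u
        using inv[OF that] .
      show "outer_square ((s / sqrt (N $ i $ i)) *\<^sub>R N $ i) = N" if "N \<in> T" for N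
        using onto[OF that] inv by auto
    qed
  qed
  have un: "\<Union> {sh 1, sh (-1)} = ?C \<inter> outer_square -` T"
  proof -
    have "outer_square u \<in> T \<longleftrightarrow> u $ i \<noteq> 0" for u :: "real ^ 'n"
    proof
      show "u $ i \<noteq> 0" if "outer_square u \<in> T"
        using that by (auto simp: T_def outer_square_def)
      assume "u $ i \<noteq> 0"
      moreover from this have "u \<noteq> 0" by auto
      ultimately show "outer_square u \<in> T"
        by (auto simp: T_def) (auto simp: outer_square_def zero_less_mult_iff)
    qed
    then show ?thesis by (auto simp: sh_def)
  qed
  have "sh 1 \<subseteq> ?C" "sh (-1) \<subseteq> ?C" by (auto simp: sh_def)
  then have "\<forall>u\<in>{sh 1, sh (-1)}. openin (top_of_set ?C) u"
    using opn by (auto intro: open_subset)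
  moreover have "pairwise disjnt {sh 1, sh (-1)}"
    by (auto simp: pairwise_def disjnt_def sh_def)
  ultimately show "\<exists>T. M \<in> T \<and> openin (top_of_set ?S) T \<and> (\<exists>v. \<Union> v = ?C \<inter> outer_square -` T \<and>
      (\<forall>u\<in>v. openin (top_of_set ?C) u) \<and> pairwise disjnt v \<and>
      (\<forall>u\<in>v. \<exists>q. homeomorphism u T outer_square q))"
    using T un hom by (intro exI[of _ T] conjI exI[of _ "{sh 1, sh (-1)}"]) auto
qed (auto simp: continuous_on_outer_square)

section \<open>Cohomology of the sphere in terms of flags\<close>

lemma continuous_map_discrete_prod:
  assumes "\<And>x. x \<in> F \<Longrightarrow> continuous_map Y Z (\<lambda>t. g (x, t))"
  shows "continuous_map (prod_topology (discrete_topology F) Y) Z g"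
  unfolding continuous_map_def
proof (intro conjI allI impI)
  show "g \<in> topspace (prod_topology (discrete_topology F) Y) \<rightarrow> topspace Z"
    using assms by (fastforce simp: continuous_map_def)
  fix U assume U: "openin Z U"
  let ?sl = "\<lambda>x. {t \<in> topspace Y. g (x, t) \<in> U}"
  have "{z \<in> topspace (prod_topology (discrete_topology F) Y). g z \<in> U} = (\<Union>x\<in>F. {x} \<times> ?sl x)"
    by auto
  moreover have "openin (prod_topology (discrete_topology F) Y) ({x} \<times> ?sl x)" if "x \<in> F" for x
    using that U assms[OF that] by (auto simp: openin_prod_Times_iff continuous_map_def)
  ultimately show "openin (prod_topology (discrete_topology F) Y)
      {z \<in> topspace (prod_topology (discrete_topology F) Y). g z \<in> U}"
    by auto
qed

lemma orbit_under_empty: "orbit_under {} x = {x}"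
  by (auto simp: orbit_under_def)

lemma orbit_under_subset:
  assumes "x \<in> S" "\<And>t z. t \<in> T \<Longrightarrow> z \<in> S \<Longrightarrow> t z \<in> S"
  shows "orbit_under T x \<subseteq> S"
proof
  fix y assume "y \<in> orbit_under T x"
  then have "(x, y) \<in> {(z, t z) | t z. t \<in> T}\<^sup>*" by (simp add: orbit_under_def)
  then show "y \<in> S" by induction (use assms in auto)
qed

lemma orbit_under_involution:
  assumes "t (t x) = x"
  shows "orbit_under {t} x \<subseteq> {x, t x}"
  using assms by (intro orbit_under_subset) auto

text \<open>
  Two-colourings as signs: a colour change multiplies by \<open>-1\<close>.
\<close>

definition sign_of :: "bool \<Rightarrow> real" where "sign_of p = (if p then -1 else 1)"

lemma sign_of_mult: "sign_of p * sign_of q = sign_of (p \<noteq> q)" by (auto simp: sign_of_def)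

lemma sign_of_eq_iff: "sign_of p = sign_of q \<longleftrightarrow> p = q" by (auto simp: sign_of_def)

lemma plane_graph_ribbon: "plane_graph G \<Longrightarrow> ribbon_graph G"
  by (simp add: plane_graph_def)

lemma topspace_triangle_space: "topspace (triangle_space G) = flags G \<times> flag_triangle"
  by (auto simp: triangle_space_def)

lemma plane_graph_parametrisation:
  assumes "plane_graph G" "flags G \<noteq> {}"
  obtains p where
    "quotient_map (triangle_space G) (top_of_set (sphere (0 :: real ^ 3) 1)) p"
    "\<And>z w. z \<in> flags G \<times> flag_triangle \<Longrightarrow> w \<in> flags G \<times> flag_triangle \<Longrightarrow>
        p z = p w \<longleftrightarrow> glued G z w"
  using assms unfolding plane_graph_def topspace_triangle_space by blast

text \<open>
  Otherwise the indicator function of \<open>S\<close> on the triangles respects the gluing, hence descends to a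
  continuous function from the sphere onto \<open>{0, 1}\<close>.
\<close>

lemma flags_connected:
  assumes G: "plane_graph G"
    and S: "S \<subseteq> flags G" "S \<noteq> {}"
      "\<And>x. x \<in> S \<Longrightarrow> corner_map G x \<in> S \<and> arc_map G x \<in> S \<and> side_map G x \<in> S"
  shows "S = flags G"
proof (rule ccontr)
  assume ne: "S \<noteq> flags G"
  note R = plane_graph_ribbon[OF G]
  note f = ribbon_graph_flagD[OF R]
  have compl: "corner_map G x \<in> flags G - S \<and> arc_map G x \<in> flags G - S \<and> side_map G x \<in> flags G - S"
    if "x \<in> flags G - S" for x
    using S(3)[of "corner_map G x"] S(3)[of "arc_map G x"] S(3)[of "side_map G x"]
      f(2,4,5,7,8,10)[of x] that by auto
  obtain p where p: "quotient_map (triangle_space G) (top_of_set (sphere (0 :: real ^ 3) 1)) p"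
    "\<And>z w. z \<in> flags G \<times> flag_triangle \<Longrightarrow> w \<in> flags G \<times> flag_triangle \<Longrightarrow>
        p z = p w \<longleftrightarrow> glued G z w"
    by (rule plane_graph_parametrisation[OF G]) (use S in blast, rule that)
  define h :: "'a \<times> real \<times> real \<times> real \<Rightarrow> real" where "h z = of_bool (fst z \<in> S)" for z
  have hc: "continuous_map (triangle_space G) euclidean h"
    unfolding triangle_space_def by (intro continuous_map_discrete_prod) (simp add: h_def)
  have hw: "h z = h w"
    if "z \<in> topspace (triangle_space G)" "w \<in> topspace (triangle_space G)" "p z = p w" for z w
  proof -
    obtain x a b c where z: "z = (x, a, b, c)" by (cases z) auto
    obtain y q where w: "w = (y, q)" by (cases w) auto
    have xy: "x \<in> flags G" "y \<in> flags G" using that z w by (auto simp: topspace_triangle_space)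
    have "glued G z w" using that p(2)[of z w] by (simp add: topspace_triangle_space)
    then have y: "y \<in> orbit_under ((if a = 0 then {side_map G} else {}) \<union>
        (if b = 0 then {corner_map G} else {}) \<union> (if c = 0 then {arc_map G} else {})) x"
      (is "y \<in> orbit_under ?T x")
      by (simp add: z w)
    have T: "t = side_map G \<or> t = corner_map G \<or> t = arc_map G" if "t \<in> ?T" for t
      using that by (auto split: if_splits)
    have "y \<in> S" if "x \<in> S"
    proof -
      have "orbit_under ?T x \<subseteq> S"
        by (rule orbit_under_subset[OF that]) (use T S(3) in metis)
      then show ?thesis using y by blast
    qed
    moreover have "y \<in> flags G - S" if "x \<in> flags G - S"
    proof -
      have "orbit_under ?T x \<subseteq> flags G - S"
        by (rule orbit_under_subset[OF that]) (use T compl in metis)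
      then show ?thesis using y by blast
    qed
    ultimately have "x \<in> S \<longleftrightarrow> y \<in> S" using xy(1) by blast
    then show ?thesis by (simp add: h_def z w)
  qed
  obtain k where k: "continuous_map (top_of_set (sphere (0 :: real ^ 3) 1)) euclidean k"
    "k ` topspace (top_of_set (sphere (0 :: real ^ 3) 1)) = h ` topspace (triangle_space G)"
    by (rule quotient_map_lift_exists[OF p(1) hc hw]) (assumption, assumption, assumption, rule that)
  have "connected (k ` sphere (0 :: real ^ 3) 1)"
    using k(1) by (intro connected_continuous_image connected_sphere) simp_all
  then have con: "connected (h ` topspace (triangle_space G))" using k(2) by simp
  obtain x y where xy: "x \<in> S" "x \<in> flags G" "y \<in> flags G" "y \<notin> S" using S(1,2) ne by auto
  have "(1, 0, 0) \<in> flag_triangle" by (simp add: flag_triangle_def)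
  then have "h (x, 1, 0, 0) \<in> h ` topspace (triangle_space G)"
    "h (y, 1, 0, 0) \<in> h ` topspace (triangle_space G)"
    using xy by (simp_all add: topspace_triangle_space)
  then have "1 \<in> h ` topspace (triangle_space G)" "0 \<in> h ` topspace (triangle_space G)"
    using xy by (simp_all add: h_def)
  then have "(1/2 :: real) \<in> h ` topspace (triangle_space G)"
    using connectedD_interval[OF con, of 0 1 "1/2"] by simp
  then show False by (auto simp: h_def of_bool_def split: if_splits)
qed

text \<open>
  The local solutions \<open>P\<close>, \<open>Q\<close>, \<open>R\<close> belong to vertices, edges and faces: \<open>P\<close> is used along corners
  and arcs, \<open>Q\<close> along arcs and sides, \<open>R\<close> along sides and corners. A prescription of colour changes
  sums to zero around every vertex, edge and face, i.e. is a cocycle with coefficients in the field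
  with two elements, iff it is induced by such a triple. So this says that every cocycle is a
  coboundary.
\<close>

definition cocycles_trivial :: "('f, 'e, 'd) arrow_ribbon \<Rightarrow> bool" where
  "cocycles_trivial G \<longleftrightarrow> (\<forall>(P :: 'f \<Rightarrow> bool) (Q :: 'f \<Rightarrow> bool) (R :: 'f \<Rightarrow> bool).
     (\<forall>x \<in> flags G. (P (arc_map G x) \<noteq> P x \<longleftrightarrow> Q (arc_map G x) \<noteq> Q x) \<and>
        (Q (side_map G x) \<noteq> Q x \<longleftrightarrow> R (side_map G x) \<noteq> R x) \<and>
        (P (corner_map G x) \<noteq> P x \<longleftrightarrow> R (corner_map G x) \<noteq> R x)) \<longrightarrow>
     (\<exists>f :: 'f \<Rightarrow> bool. \<forall>x \<in> flags G. (f (arc_map G x) \<noteq> f x \<longleftrightarrow> P (arc_map G x) \<noteq> P x) \<and>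
        (f (side_map G x) \<noteq> f x \<longleftrightarrow> Q (side_map G x) \<noteq> Q x) \<and>
        (f (corner_map G x) \<noteq> f x \<longleftrightarrow> R (corner_map G x) \<noteq> R x)))"

lemma convex_flag_triangle: "convex flag_triangle"
proof (rule convexI)
  fix s t :: "real \<times> real \<times> real" and u v :: real
  assume st: "s \<in> flag_triangle" "t \<in> flag_triangle" and uv: "0 \<le> u" "0 \<le> v" "u + v = 1"
  obtain a b c a' b' c' where s: "s = (a, b, c)" and t: "t = (a', b', c')"
    by (cases s, cases t) auto
  have "(u * a + v * a') + (u * b + v * b') + (u * c + v * c') = u * (a + b + c) + v * (a' + b' + c')"
    by (simp add: algebra_simps)
  also have "\<dots> = 1" using st uv by (simp add: s t flag_triangle_def)
  finally show "u *\<^sub>R s + v *\<^sub>R t \<in> flag_triangle"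
    using st uv by (simp add: s t flag_triangle_def)
qed

text \<open>
  On the triangle of the flag \<open>x\<close> put \<open>u = (\<plusminus>a, \<plusminus>b, \<plusminus>c)\<close>, where \<open>(a, b, c)\<close> are the barycentric
  coordinates and the signs are given by \<open>P x\<close>, \<open>Q x\<close> and \<open>R x\<close>. On a side of the triangle one
  coordinate vanishes, and in passing to the adjacent triangle the other two change sign
  simultaneously or not at all. Hence \<open>u\<close> is well
  defined up to sign on the sphere, and its outer square is a continuous function there. The sphere
  is simply connected, so this function lifts through the double covering to a continuous \<open>v\<close>. On each
  triangle \<open>v\<close> equals \<open>u\<close> or \<open>-u\<close>, and this sign, as a function of the flag, is the required
  colouring.
\<close>

lemma plane_graph_cocycles_trivial:
  assumes G: "plane_graph G"
  shows "cocycles_trivial G"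
  unfolding cocycles_trivial_def
proof (intro allI impI)
  fix P Q R :: "'a \<Rightarrow> bool"
  assume PQR: "\<forall>x \<in> flags G. (P (arc_map G x) \<noteq> P x \<longleftrightarrow> Q (arc_map G x) \<noteq> Q x) \<and>
        (Q (side_map G x) \<noteq> Q x \<longleftrightarrow> R (side_map G x) \<noteq> R x) \<and>
        (P (corner_map G x) \<noteq> P x \<longleftrightarrow> R (corner_map G x) \<noteq> R x)"
  show "\<exists>f :: 'a \<Rightarrow> bool. \<forall>x \<in> flags G. (f (arc_map G x) \<noteq> f x \<longleftrightarrow> P (arc_map G x) \<noteq> P x) \<and>
        (f (side_map G x) \<noteq> f x \<longleftrightarrow> Q (side_map G x) \<noteq> Q x) \<and>
        (f (corner_map G x) \<noteq> f x \<longleftrightarrow> R (corner_map G x) \<noteq> R x)"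
  proof (cases "flags G = {}")
    case False
    note fl = ribbon_graph_flagD[OF plane_graph_ribbon[OF G]]
    obtain p where p: "quotient_map (triangle_space G) (top_of_set (sphere (0 :: real ^ 3) 1)) p"
      "\<And>z w. z \<in> flags G \<times> flag_triangle \<Longrightarrow> w \<in> flags G \<times> flag_triangle \<Longrightarrow>
        p z = p w \<longleftrightarrow> glued G z w"
      by (rule plane_graph_parametrisation[OF G False]) (rule that)
    define u :: "'a \<times> real \<times> real \<times> real \<Rightarrow> real ^ 3" where
      "u = (\<lambda>(x, a, b, c). vector [sign_of (P x) * a, sign_of (Q x) * b, sign_of (R x) * c])"
    have u_comp: "u (x, a, b, c) $ 1 = sign_of (P x) * a" "u (x, a, b, c) $ 2 = sign_of (Q x) * b"
      "u (x, a, b, c) $ 3 = sign_of (R x) * c" for x a b c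
      by (auto simp: u_def)
    have u_eq: "u z = v \<longleftrightarrow> u z $ 1 = v $ 1 \<and> u z $ 2 = v $ 2 \<and> u z $ 3 = v $ 3" for z v
      by (auto simp: vec_eq_iff forall_3)
    have u_nz: "u (x, t) \<noteq> 0" if "t \<in> flag_triangle" for x t
      using that by (auto simp: u_eq u_comp sign_of_def flag_triangle_def split: if_splits)
    have u_cont: "continuous_on flag_triangle (\<lambda>t. u (x, t))" for x
    proof -
      have comp: "u (x, t) $ 1 = sign_of (P x) * fst t" "u (x, t) $ 2 = sign_of (Q x) * fst (snd t)"
        "u (x, t) $ 3 = sign_of (R x) * snd (snd t)" for t
        by (cases t; simp add: u_comp)+
      have "\<forall>i. continuous_on flag_triangle (\<lambda>t. u (x, t) $ i)"
        unfolding forall_3 comp by (intro conjI continuous_intros)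
      then have "continuous_on flag_triangle (\<lambda>t. \<chi> i. u (x, t) $ i)"
        by (intro continuous_on_vec_lambda) blast
      then show ?thesis by simp
    qed
    have uc: "continuous_map (triangle_space G) (top_of_set (outer_square ` (- {0}))) (outer_square \<circ> u)"
      unfolding triangle_space_def
    proof (rule continuous_map_discrete_prod)
      fix x
      show "continuous_map (top_of_set flag_triangle) (top_of_set (outer_square ` (- {0})))
          (\<lambda>t. (outer_square \<circ> u) (x, t))"
        using continuous_on_compose[OF u_cont[of x] continuous_on_outer_square] u_nz
        by (auto simp: continuous_map_in_subtopology o_def)
    qed
    have uw: "(outer_square \<circ> u) z = (outer_square \<circ> u) w"
      if zw: "z \<in> topspace (triangle_space G)" "w \<in> topspace (triangle_space G)" "p z = p w" for z w
    proof -
      obtain x a b c where z: "z = (x, a, b, c)" by (cases z) auto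
      have "glued G z w" using zw p(2)[of z w] by (simp add: topspace_triangle_space)
      then obtain y where w: "w = (y, a, b, c)"
        and y: "y \<in> orbit_under ((if a = 0 then {side_map G} else {}) \<union>
          (if b = 0 then {corner_map G} else {}) \<union> (if c = 0 then {arc_map G} else {})) x"
        by (cases w) (auto simp: z)
      have x: "x \<in> flags G" using zw z by (simp add: topspace_triangle_space)
      note inv = orbit_under_involution[of "side_map G" x] orbit_under_involution[of "corner_map G" x]
        orbit_under_involution[of "arc_map G" x]
      have "u z = u w \<or> u z = - u w"
      proof -
        \<comment> \<open>At a corner of the triangle, \<open>u\<close> has a single nonzero coordinate, so the flag is irrelevant up to sign.\<close>
        consider "a \<noteq> 0" "b \<noteq> 0" "c \<noteq> 0" | "a = 0" "b \<noteq> 0" "c \<noteq> 0" | "a \<noteq> 0" "b = 0" "c \<noteq> 0"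
          | "a \<noteq> 0" "b \<noteq> 0" "c = 0" | "a = 0" "b = 0" | "a = 0" "c = 0" | "b = 0" "c = 0"
          by blast
        then show ?thesis
        proof cases
          case 1
          then show ?thesis using y by (simp add: orbit_under_empty z w)
        next
          case 2
          then have "y = x \<or> y = side_map G x" using y inv fl[OF x] by auto
          then show ?thesis using bspec[OF PQR x] 2
            by (elim disjE; cases "Q y = Q x") (simp_all add: z w u_eq u_comp sign_of_def)
        next
          case 3
          then have "y = x \<or> y = corner_map G x" using y inv fl[OF x] by auto
          then show ?thesis using bspec[OF PQR x] 3
            by (elim disjE; cases "P y = P x") (simp_all add: z w u_eq u_comp sign_of_def)
        next
          case 4
          then have "y = x \<or> y = arc_map G x" using y inv fl[OF x] by auto
          then show ?thesis using bspec[OF PQR x] 4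
            by (elim disjE; cases "P y = P x") (simp_all add: z w u_eq u_comp sign_of_def)
        qed (auto simp: z w u_eq u_comp sign_of_def)
      qed
      moreover have "outer_square (- v) = outer_square v" for v :: "real ^ 3"
        by (simp add: outer_square_def)
      ultimately show ?thesis by auto
    qed
    obtain k where k:
      "continuous_map (top_of_set (sphere (0 :: real ^ 3) 1)) (top_of_set (outer_square ` (- {0}))) k"
      "\<And>z. z \<in> topspace (triangle_space G) \<Longrightarrow> k (p z) = (outer_square \<circ> u) z"
      by (rule quotient_map_lift_exists[OF p(1) uc uw]) (assumption, assumption, assumption, rule that)
    have kc: "continuous_on (sphere 0 1) k" "k \<in> sphere (0 :: real ^ 3) 1 \<rightarrow> outer_square ` (- {0})"
      using k(1) by (auto simp: continuous_map_in_subtopology)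
    obtain v where v: "continuous_on (sphere (0 :: real ^ 3) 1) v"
      "\<And>y. y \<in> sphere 0 1 \<Longrightarrow> outer_square (v y) = k y"
    proof (rule covering_space_lift[OF covering_space_outer_square _ _ kc])
      show "simply_connected (sphere (0 :: real ^ 3) 1)" by (rule simply_connected_sphere) simp
      show "locally path_connected (sphere (0 :: real ^ 3) 1)" by (rule locally_path_connected_sphere)
    qed (rule that)
    have pc: "continuous_map (triangle_space G) (top_of_set (sphere (0 :: real ^ 3) 1)) p"
      using p(1) by (rule quotient_imp_continuous_map)
    have vu: "v (p (x, t)) = u (x, t) \<or> v (p (x, t)) = - u (x, t)"
      and ps: "p (x, t) \<in> sphere 0 1"
      if "x \<in> flags G" "t \<in> flag_triangle" for x t
    proof -
      show "p (x, t) \<in> sphere 0 1"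
        using that pc by (auto simp: continuous_map_def topspace_triangle_space Pi_iff)
      then show "v (p (x, t)) = u (x, t) \<or> v (p (x, t)) = - u (x, t)"
        using v(2)[of "p (x, t)"] k(2)[of "(x, t)"] that
        by (intro outer_square_eqD) (simp add: topspace_triangle_space)
    qed
    \<comment> \<open>The inner product with \<open>u\<close> shows by which sign \<open>v\<close> differs from \<open>u\<close>; it has no zeros on a triangle.\<close>
    define r where "r x t = v (p (x, t)) \<bullet> u (x, t)" for x t
    have r_nz: "r x t \<noteq> 0" if "x \<in> flags G" "t \<in> flag_triangle" for x t
      using vu[OF that] u_nz[OF that(2), of x] by (auto simp: r_def)
    define f where "f x \<longleftrightarrow> r x (1/3, 1/3, 1/3) < 0" for x
    have mid: "(1/3, 1/3, 1/3) \<in> flag_triangle" by (simp add: flag_triangle_def)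
    have r_sgn: "r x t < 0 \<longleftrightarrow> f x" if x: "x \<in> flags G" and t: "t \<in> flag_triangle" for x t
    proof -
      have "connected flag_triangle" using convex_flag_triangle by (rule convex_connected)
      moreover have "continuous_on flag_triangle (r x)"
      proof -
        have "continuous_map (top_of_set flag_triangle) (triangle_space G) (Pair x)"
          unfolding triangle_space_def using x by (auto intro!: continuous_map_pairedI)
        then have "continuous_map (top_of_set flag_triangle) (top_of_set (sphere (0 :: real ^ 3) 1)) (p \<circ> Pair x)"
          using pc continuous_map_compose by blast
        then have c: "continuous_on flag_triangle (\<lambda>t. p (x, t))"
          by (auto simp: continuous_map_in_subtopology o_def)
        have "continuous_on flag_triangle (\<lambda>t. v (p (x, t)))"
          using ps[OF x] by (intro continuous_on_compose2[OF v(1) c]) auto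
        then show ?thesis
          unfolding r_def by (intro continuous_intros u_cont)
      qed
      ultimately have con: "connected (r x ` flag_triangle)"
        by (intro connected_continuous_image)
      have z: "0 \<notin> r x ` flag_triangle" using r_nz[OF x] by force
      have "r x t \<in> r x ` flag_triangle" "r x (1/3, 1/3, 1/3) \<in> r x ` flag_triangle"
        using t mid by auto
      then show ?thesis
        unfolding f_def using connectedD_interval[OF con, of "r x t" "r x (1/3, 1/3, 1/3)" 0]
          connectedD_interval[OF con, of "r x (1/3, 1/3, 1/3)" "r x t" 0] z
        by (cases "r x t < 0"; cases "r x (1/3, 1/3, 1/3) < 0") simp_all
    qed
    have v_eq: "v (p (x, t)) = sign_of (f x) *\<^sub>R u (x, t)" if x: "x \<in> flags G" "t \<in> flag_triangle" for x t
    proof -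
      have "\<not> u (x, t) \<bullet> u (x, t) < 0" "- (u (x, t) \<bullet> u (x, t)) < 0"
        using u_nz[OF that(2), of x] by (simp_all add: not_less)
      then show ?thesis
        using vu[OF that] r_sgn[OF that, symmetric]
        by (elim disjE) (simp_all only: r_def sign_of_def inner_minus_left if_True if_False
            scaleR_one scaleR_minus1_left simp_thms)
    qed
    have transfer: "sign_of (f x) *\<^sub>R u (x, a, b, c) = sign_of (f y) *\<^sub>R u (y, a, b, c)"
      if x: "x \<in> flags G" "y \<in> flags G" "(a, b, c) \<in> flag_triangle"
        "a = 0 \<and> y = side_map G x \<or> b = 0 \<and> y = corner_map G x \<or> c = 0 \<and> y = arc_map G x" for x y a b c
    proof -
      have step: "t x \<in> orbit_under T x" if "t \<in> T" for t :: "'a \<Rightarrow> 'a" and T x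
        unfolding orbit_under_def using that by auto
      have "glued G (x, a, b, c) (y, a, b, c)"
        using x(4) by (auto intro!: step)
      then have "p (x, a, b, c) = p (y, a, b, c)"
        using p(2)[of "(x, a, b, c)" "(y, a, b, c)"] x by simp
      then show ?thesis using v_eq[OF x(1) x(3)] v_eq[OF x(2) x(3)] by simp
    qed
    show ?thesis
    proof (intro exI[of _ f] ballI)
      fix x assume x: "x \<in> flags G"
      have m: "(1/2, 1/2, 0) \<in> flag_triangle" "(0, 1/2, 1/2) \<in> flag_triangle" "(1/2, 0, 1/2) \<in> flag_triangle"
        by (auto simp: flag_triangle_def)
      \<comment> \<open>Compare both triangles at the midpoint of their common side; either nonzero coordinate will do.\<close>
      note e = transfer[OF x fl(2)[OF x] m(1)] transfer[OF x fl(8)[OF x] m(2)] transfer[OF x fl(5)[OF x] m(3)]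
      have "sign_of (f x) * sign_of (P x) = sign_of (f (arc_map G x)) * sign_of (P (arc_map G x))"
        using arg_cong[OF e(1), of "\<lambda>w. w $ 1"] by (simp add: u_comp)
      moreover have "sign_of (f x) * sign_of (Q x) = sign_of (f (side_map G x)) * sign_of (Q (side_map G x))"
        using arg_cong[OF e(2), of "\<lambda>w. w $ 2"] by (simp add: u_comp)
      moreover have "sign_of (f x) * sign_of (R x) = sign_of (f (corner_map G x)) * sign_of (R (corner_map G x))"
        using arg_cong[OF e(3), of "\<lambda>w. w $ 3"] by (simp add: u_comp)
      ultimately show "(f (arc_map G x) \<noteq> f x \<longleftrightarrow> P (arc_map G x) \<noteq> P x) \<and>
        (f (side_map G x) \<noteq> f x \<longleftrightarrow> Q (side_map G x) \<noteq> Q x) \<and>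
        (f (corner_map G x) \<noteq> f x \<longleftrightarrow> R (corner_map G x) \<noteq> R x)"
        by (auto simp: sign_of_mult sign_of_eq_iff)
    qed
  qed auto
qed

section \<open>Eulerian multigraphs\<close>

definition finite_multigraph :: "('v, 'e) multigraph \<Rightarrow> bool" where
  "finite_multigraph g \<longleftrightarrow> finite (medges g) \<and>
     (\<forall>e \<in> medges g. size (ends g e) = 2 \<and> set_mset (ends g e) \<subseteq> mverts g)"

definition mdegree :: "('v, 'e) multigraph \<Rightarrow> 'v \<Rightarrow> nat" where
  "mdegree g v = (\<Sum>e \<in> medges g. count (ends g e) v)"

lemma walk_verts:
  "walk g u es v \<Longrightarrow> u \<in> mverts g \<and> v \<in> mverts g \<and> set es \<subseteq> medges g"
  by (induction es arbitrary: u) auto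

lemma walk_append: "walk g u (es @ fs) v \<longleftrightarrow> (\<exists>w. walk g u es w \<and> walk g w fs v)"
proof (induction es arbitrary: u)
  case Nil
  then show ?case using walk_verts by fastforce
next
  case (Cons e es)
  then show ?case by auto
qed

lemma walk_appendI: "walk g u es w \<Longrightarrow> walk g w fs v \<Longrightarrow> walk g u (es @ fs) v"
  using walk_append by metis

lemma walk_edge:
  assumes "e \<in> medges g" "ends g e = {#u, v#}" "u \<in> mverts g" "v \<in> mverts g"
  shows "walk g u [e] v"
  using assms by auto

lemma walk_reverse: "walk g u es v \<Longrightarrow> \<exists>fs. walk g v fs u"
proof (induction es arbitrary: u)
  case Nil
  then show ?case by (intro exI[of _ "[]"]) auto
next
  case (Cons e es)
  then obtain w where w: "u \<in> mverts g" "e \<in> medges g" "ends g e = {#u, w#}" "walk g w es v"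
    by auto
  then obtain fs where fs: "walk g v fs w" using Cons.IH by blast
  have "walk g w [e] u"
    using w walk_verts[OF w(4)] by (intro walk_edge) (auto simp: add_mset_commute)
  then have "walk g v (fs @ [e]) u" by (rule walk_appendI[OF fs])
  then show ?case by blast
qed

lemma walk_parity:
  "walk g u es v \<Longrightarrow>
     even (sum_list (map (\<lambda>e. count (ends g e) x) es) + of_bool (u = x) + of_bool (v = x))"
proof (induction es arbitrary: u)
  case Nil
  then show ?case by auto
next
  case (Cons e es)
  then obtain w where w: "ends g e = {#u, w#}" "walk g w es v" by auto
  show ?case using Cons.IH[OF w(2)] by (auto simp: w(1))
qed

lemma incident_edge:
  assumes "finite_multigraph g" "e \<in> medges g" "u \<in># ends g e"
  obtains v where "ends g e = {#u, v#}" "u \<in> mverts g" "v \<in> mverts g"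
proof -
  have s: "size (ends g e) = 2" "set_mset (ends g e) \<subseteq> mverts g"
    using assms by (auto simp: finite_multigraph_def)
  obtain M where M: "ends g e = add_mset u M" using assms(3) by (meson multi_member_split)
  then have "size M = 1" using s by simp
  then obtain v where "M = {#v#}" using size_1_singleton_mset by auto
  then show thesis using that M s by auto
qed

lemma trail_even_degrees:
  assumes "walk g u es u" "distinct es" "set es = medges g"
  shows "even (mdegree g v)"
proof -
  have "mdegree g v = sum_list (map (\<lambda>e. count (ends g e) v) es)"
    unfolding mdegree_def assms(3)[symmetric] using assms(2) by (simp add: sum_list_distinct_conv_sum_set)
  then show ?thesis using walk_parity[OF assms(1), of v] by auto
qed

text \<open>
  Take a longest trail \<open>es\<close>. It is closed, because a trail with different ends uses an odd number of
  edge ends at its last vertex, whose degree is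
  even, and could be extended there. It can be started at any of the vertices
  that it visits, so by maximality it uses every edge at each of them; by connectedness, it uses
  every edge.
\<close>

lemma closed_trail_exists:
  assumes g: "finite_multigraph g" "mconnected g" and even: "\<And>v. v \<in> mverts g \<Longrightarrow> even (mdegree g v)"
  shows "\<exists>u es. walk g u es u \<and> distinct es \<and> set es = medges g"
proof -
  have fin: "finite (medges g)" using g by (simp add: finite_multigraph_def)
  define trail where "trail = (\<lambda>(u, es, v). walk g u es v \<and> distinct es)"
  obtain u0 where u0: "u0 \<in> mverts g" using g by (auto simp: mconnected_def)
  have bound: "length es \<le> card (medges g)" if "trail (u, es, v)" for u es v
    using that walk_verts[of g u es v] card_mono[OF fin, of "set es"]
    by (auto simp: trail_def distinct_card)
  have "trail (u0, [], u0)" using u0 by (simp add: trail_def)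
  moreover have "\<forall>y. trail y \<longrightarrow> length (fst (snd y)) < Suc (card (medges g))"
    using bound by (auto simp: less_Suc_eq_le)
  ultimately obtain t where t: "trail t" "\<forall>y. trail y \<longrightarrow> length (fst (snd y)) \<le> length (fst (snd t))"
    using ex_has_greatest_nat[of trail _ "\<lambda>y. length (fst (snd y))"] by blast
  obtain u es v where tt: "t = (u, es, v)" by (cases t) auto
  have es: "walk g u es v" "distinct es" using t(1) by (auto simp: tt trail_def)
  have longest: "length fs \<le> length es" if "walk g a fs b" "distinct fs" for a fs b
    using t(2)[rule_format, of "(a, fs, b)"] that by (simp add: tt trail_def)
  have no_ext: "e \<in> set fs"
    if fs: "walk g a fs b" "distinct fs" "length fs = length es" "e \<in> medges g" "b \<in># ends g e" for a fs b e
  proof (rule ccontr)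
    assume e: "e \<notin> set fs"
    obtain w where "ends g e = {#b, w#}" "b \<in> mverts g" "w \<in> mverts g"
      using incident_edge[OF g(1) fs(4,5)] .
    then have "walk g b [e] w" using fs(4) by (intro walk_edge)
    then have "walk g a (fs @ [e]) w" by (rule walk_appendI[OF fs(1)])
    then have "length (fs @ [e]) \<le> length es" by (rule longest) (use fs(2) e in simp)
    then show False using fs(3) by simp
  qed
  have uv: "u = v"
  proof (rule ccontr)
    assume "u \<noteq> v"
    then have o: "odd (\<Sum>e \<in> set es. count (ends g e) v)"
      using walk_parity[OF es(1), of v] es(2) by (auto simp: sum_list_distinct_conv_sum_set)
    have "set es \<subseteq> medges g" "v \<in> mverts g" using walk_verts[OF es(1)] by auto
    moreover from this have "mdegree g v = (\<Sum>e \<in> medges g - set es. count (ends g e) v)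
        + (\<Sum>e \<in> set es. count (ends g e) v)"
      unfolding mdegree_def using fin by (intro sum.subset_diff)
    ultimately have "(\<Sum>e \<in> medges g - set es. count (ends g e) v) \<noteq> 0"
      using o even by (metis add_0)
    then obtain e where "e \<in> medges g - set es" "count (ends g e) v \<noteq> 0"
      by (meson sum.neutral)
    then show False using no_ext[OF es, of e] by (auto simp: not_in_iff)
  qed
  \<comment> \<open>The vertices visited by the trail.\<close>
  define X where "X = {w. \<exists>es1 es2. es = es1 @ es2 \<and> walk g u es1 w \<and> walk g w es2 u}"
  have used: "e \<in> set es" if "w \<in> X" "e \<in> medges g" "w \<in># ends g e" for w e
  proof -
    obtain es1 es2 where s: "es = es1 @ es2" "walk g u es1 w" "walk g w es2 u"
      using \<open>w \<in> X\<close> by (auto simp: X_def)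
    have "walk g w (es2 @ es1) w" using s(3,2) by (rule walk_appendI)
    moreover have "distinct (es2 @ es1)" using es(2) s by auto
    ultimately have "e \<in> set (es2 @ es1)" using no_ext[of w "es2 @ es1" w e] that s by auto
    then show ?thesis using s by auto
  qed
  have inX: "w \<in> X" if "e \<in> set es" "w \<in># ends g e" for e w
  proof -
    obtain es1 es2 where s: "es = es1 @ e # es2" using \<open>e \<in> set es\<close> by (meson split_list)
    then have "walk g u (es1 @ e # es2) u" using es(1) uv by simp
    then obtain a where a: "walk g u es1 a" "walk g a (e # es2) u" unfolding walk_append by blast
    then obtain b where b: "ends g e = {#a, b#}" "walk g b es2 u" "e \<in> medges g" "a \<in> mverts g"
      by auto
    then have "walk g a [e] b" using walk_verts[OF b(2)] by (intro walk_edge) auto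
    then have "walk g u (es1 @ [e]) b" by (rule walk_appendI[OF a(1)])
    then have "b \<in> X" unfolding X_def using s b(2)
      by (intro CollectI exI[of _ "es1 @ [e]"] exI[of _ es2]) simp
    moreover have "a \<in> X" unfolding X_def using s a by blast
    ultimately show ?thesis using that b by auto
  qed
  have step: "b \<in> X" if "walk g a fs b" "a \<in> X" for a fs b
    using that
  proof (induction fs arbitrary: a)
    case (Cons e fs)
    then obtain w where w: "e \<in> medges g" "ends g e = {#a, w#}" "walk g w fs b" by auto
    then have "w \<in> X" using used[OF Cons.prems(2), of e] inX[of e w] by simp
    then show ?case using Cons.IH w by blast
  qed simp
  have uX: "u \<in> X"
    unfolding X_def using es uv walk_verts[OF es(1)]
    by (intro CollectI exI[of _ "[]"] exI[of _ es]) simp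
  have "e \<in> set es" if e: "e \<in> medges g" for e
  proof -
    have "ends g e \<noteq> {#}" "set_mset (ends g e) \<subseteq> mverts g"
      using g(1) e by (auto simp: finite_multigraph_def)
    then obtain w where w: "w \<in># ends g e" "w \<in> mverts g" by (metis multiset_nonemptyE subsetD)
    then obtain fs where "walk g u fs w"
      using g(2) walk_verts[OF es(1)] unfolding mconnected_def by blast
    then show ?thesis using used[OF step[OF _ uX] e w(1)] by blast
  qed
  then show ?thesis using es uv walk_verts[OF es(1)] by blast
qed

lemma eulerian_iff_even_degrees:
  assumes "finite_multigraph g"
  shows "eulerian g \<longleftrightarrow> mconnected g \<and> (\<forall>v \<in> mverts g. even (mdegree g v))"
proof
  assume "eulerian g"
  then obtain u es where "mconnected g" "walk g u es u" "distinct es" "set es = medges g"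
    unfolding eulerian_def by metis
  then show "mconnected g \<and> (\<forall>v \<in> mverts g. even (mdegree g v))" using trail_even_degrees by metis
next
  assume "mconnected g \<and> (\<forall>v \<in> mverts g. even (mdegree g v))"
  then show "eulerian g" unfolding eulerian_def using closed_trail_exists[OF assms] by simp
qed

lemma component_verts: "mverts (mcomponent g u) = {v. \<exists>es. walk g u es v}"
  and component_edges: "medges (mcomponent g u) = {e \<in> medges g. set_mset (ends g e) \<subseteq> {v. \<exists>es. walk g u es v}}"
  and component_ends: "ends (mcomponent g u) = ends g"
  by (auto simp: mcomponent_def Let_def)

lemma component_closed:
  assumes g: "finite_multigraph g" and v: "v \<in> mverts (mcomponent g u)"
    and e: "e \<in> medges g" "v \<in># ends g e"
  shows "e \<in> medges (mcomponent g u)"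
proof -
  obtain w where w: "ends g e = {#v, w#}" "v \<in> mverts g" "w \<in> mverts g"
    using incident_edge[OF g e] .
  obtain es where "walk g u es v" using v by (auto simp: component_verts)
  moreover have "walk g v [e] w" using walk_edge w e by metis
  ultimately have "walk g u (es @ [e]) w" by (rule walk_appendI)
  then show ?thesis using \<open>walk g u es v\<close> w e by (auto simp: component_edges)
qed

lemma finite_multigraph_component:
  assumes "finite_multigraph g"
  shows "finite_multigraph (mcomponent g u)"
  using assms by (auto simp: finite_multigraph_def component_verts component_edges component_ends)

lemma mdegree_component:
  assumes g: "finite_multigraph g" and v: "v \<in> mverts (mcomponent g u)"
  shows "mdegree (mcomponent g u) v = mdegree g v"
proof -
  have "count (ends g e) v = 0" if "e \<in> medges g - medges (mcomponent g u)" for e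
    using component_closed[OF g v, of e] that by (auto simp: count_eq_zero_iff)
  then show ?thesis
    unfolding mdegree_def component_ends using g
    by (intro sum.mono_neutral_left) (auto simp: component_edges finite_multigraph_def)
qed

lemma mconnected_component:
  assumes g: "finite_multigraph g" and u: "u \<in> mverts g"
  shows "mconnected (mcomponent g u)"
proof -
  have lift: "walk (mcomponent g u) a es b"
    if "walk g a es b" "a \<in> mverts (mcomponent g u)" for a es b
    using that
  proof (induction es arbitrary: a)
    case (Cons e es)
    then obtain w where w: "e \<in> medges g" "ends g e = {#a, w#}" "walk g w es b" by auto
    then have e: "e \<in> medges (mcomponent g u)"
      using component_closed[OF g Cons.prems(2)] by simp
    then have "w \<in> mverts (mcomponent g u)"
      using w(2) by (simp add: component_edges component_verts)
    then have "walk (mcomponent g u) w es b" using Cons.IH w(3) by blast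
    then show ?case using e w(2) Cons.prems(2) by (auto simp: component_ends)
  qed simp
  have "walk g u [] u" using u by simp
  then have "u \<in> mverts (mcomponent g u)" unfolding component_verts by blast
  moreover have "\<exists>es. walk (mcomponent g u) a es b"
    if ab: "a \<in> mverts (mcomponent g u)" "b \<in> mverts (mcomponent g u)" for a b
  proof -
    obtain es fs where "walk g u es a" "walk g u fs b" using ab by (auto simp: component_verts)
    obtain es' where "walk g a es' u" using walk_reverse[OF \<open>walk g u es a\<close>] by blast
    then have "walk g a (es' @ fs) b" using \<open>walk g u fs b\<close> by (rule walk_appendI)
    then have "walk (mcomponent g u) a (es' @ fs) b" using ab(1) by (rule lift)
    then show ?thesis by blast
  qed
  ultimately show ?thesis unfolding mconnected_def by blast
qed

lemma components_eulerian_iff_even_degrees: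
  assumes "finite_multigraph g"
  shows "(\<forall>K \<in> mcomponents g. eulerian K) \<longleftrightarrow> (\<forall>v \<in> mverts g. even (mdegree g v))"
proof -
  have "eulerian (mcomponent g u) \<longleftrightarrow> (\<forall>v \<in> mverts (mcomponent g u). even (mdegree g v))"
    if "u \<in> mverts g" for u
    using eulerian_iff_even_degrees[OF finite_multigraph_component[OF assms]]
      mconnected_component[OF assms that] mdegree_component[OF assms] by auto
  moreover have "v \<in> mverts (mcomponent g v)" if "v \<in> mverts g" for v
  proof -
    have "walk g v [] v" using that by simp
    then show ?thesis unfolding component_verts by blast
  qed
  moreover have "mverts (mcomponent g u) \<subseteq> mverts g" for u
    using walk_verts by (fastforce simp: component_verts)
  ultimately show ?thesis unfolding mcomponents_def by blast
qed

lemma finite_multigraph_edge_induced: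
  assumes "finite_multigraph g" "A \<subseteq> medges g"
  shows "finite_multigraph (edge_induced g A)"
  using assms finite_subset by (fastforce simp: finite_multigraph_def edge_induced_def)

lemma components_edge_induced_eulerian_iff:
  assumes g: "finite_multigraph g" and A: "A \<subseteq> medges g"
  shows "(\<forall>K \<in> mcomponents (edge_induced g A). eulerian K) \<longleftrightarrow>
    (\<forall>v. even (\<Sum>e \<in> A. count (ends g e) v))"
proof -
  have deg: "mdegree (edge_induced g A) v = (\<Sum>e \<in> A. count (ends g e) v)" for v
    by (simp add: mdegree_def edge_induced_def)
  have "(\<Sum>e \<in> A. count (ends g e) v) = 0" if v: "v \<notin> mverts (edge_induced g A)" for v
  proof (rule sum.neutral, rule ballI)
    fix e assume e: "e \<in> A"
    have "v \<notin># ends g e"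
    proof
      assume "v \<in># ends g e"
      moreover from this have "v \<in> mverts g" using g A e by (auto simp: finite_multigraph_def)
      ultimately show False using v e by (auto simp: edge_induced_def)
    qed
    then show "count (ends g e) v = 0" by (simp add: not_in_iff)
  qed
  then have "(\<forall>v \<in> mverts (edge_induced g A). even (\<Sum>e \<in> A. count (ends g e) v)) \<longleftrightarrow>
    (\<forall>v. even (\<Sum>e \<in> A. count (ends g e) v))"
    by (metis even_zero)
  then show ?thesis
    using components_eulerian_iff_even_degrees[OF finite_multigraph_edge_induced[OF g A]] by (simp add: deg)
qed

section \<open>Linear systems and parity\<close>

text \<open>
  A finite linear system is solvable if every linear relation between its rows is satisfied by the
  right-hand side. The induction adds an unknown \<open>x0\<close>. If the system fails without it, some relation
  \<open>y0\<close> between the shorter rows is violated by \<open>b\<close>; it determines the value \<open>l\<close> of the new unknown,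
  and subtracting a multiple of \<open>y0\<close> turns any relation between the shorter rows into one between
  the full rows.
\<close>

lemma fredholm_alternative:
  fixes M :: "'i \<Rightarrow> 'x \<Rightarrow> 'k :: field"
  assumes "finite X" "finite I"
    and "\<And>y. (\<And>x. x \<in> X \<Longrightarrow> (\<Sum>i\<in>I. y i * M i x) = 0) \<Longrightarrow> (\<Sum>i\<in>I. y i * b i) = 0"
  shows "\<exists>r. \<forall>i\<in>I. (\<Sum>x\<in>X. M i x * r x) = b i"
  using assms(1,3)
proof (induction X arbitrary: b rule: finite_induct)
  case empty
  have "b i = 0" if i: "i \<in> I" for i
    using empty[of "\<lambda>j. if j = i then 1 else 0"] \<open>finite I\<close> i by (simp add: if_distrib[of "\<lambda>z. z * _"] cong: if_cong)
  then show ?case by simp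
next
  case (insert x0 X)
  show ?case
  proof (cases "\<forall>y. (\<forall>x\<in>X. (\<Sum>i\<in>I. y i * M i x) = 0) \<longrightarrow> (\<Sum>i\<in>I. y i * b i) = 0")
    case True
    then obtain r where r: "\<forall>i\<in>I. (\<Sum>x\<in>X. M i x * r x) = b i" using insert.IH[of b] by blast
    have "(\<Sum>x\<in>insert x0 X. M i x * (r(x0 := 0)) x) = (\<Sum>x\<in>X. M i x * r x)" for i
    proof -
      have "(\<Sum>x\<in>X. M i x * (r(x0 := 0)) x) = (\<Sum>x\<in>X. M i x * r x)"
        using insert.hyps by (intro sum.cong) auto
      then show ?thesis using insert.hyps by simp
    qed
    then show ?thesis using r by (intro exI[of _ "r(x0 := 0)"]) simp
  next
    case False
    then obtain y0 where y0: "\<And>x. x \<in> X \<Longrightarrow> (\<Sum>i\<in>I. y0 i * M i x) = 0" "(\<Sum>i\<in>I. y0 i * b i) \<noteq> 0"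
      by blast
    define m where "m = (\<Sum>i\<in>I. y0 i * M i x0)"
    have m: "m \<noteq> 0" using insert.prems[of y0] y0 by (auto simp: m_def)
    define l where "l = (\<Sum>i\<in>I. y0 i * b i) / m"
    have "(\<Sum>i\<in>I. y i * (b i - M i x0 * l)) = 0"
      if y: "\<And>x. x \<in> X \<Longrightarrow> (\<Sum>i\<in>I. y i * M i x) = 0" for y
    proof -
      define k where "k = (\<Sum>i\<in>I. y i * M i x0)"
      have lin: "(\<Sum>i\<in>I. (y i - k / m * y0 i) * c i) = (\<Sum>i\<in>I. y i * c i) - k / m * (\<Sum>i\<in>I. y0 i * c i)" for c
        by (simp add: sum_distrib_left sum_subtractf algebra_simps)
      have "(\<Sum>i\<in>I. (y i - k / m * y0 i) * b i) = 0"
      proof (rule insert.prems)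
        fix x assume "x \<in> insert x0 X"
        then show "(\<Sum>i\<in>I. (y i - k / m * y0 i) * M i x) = 0"
          unfolding lin using y y0(1) m by (auto simp: k_def[symmetric] m_def[symmetric])
      qed
      then have "(\<Sum>i\<in>I. y i * b i) = k * l" unfolding lin by (simp add: l_def)
      then show ?thesis
        by (simp add: right_diff_distrib sum_subtractf mult.assoc[symmetric] sum_distrib_right[symmetric] k_def)
    qed
    then obtain r where r: "\<forall>i\<in>I. (\<Sum>x\<in>X. M i x * r x) = b i - M i x0 * l"
      using insert.IH[of "\<lambda>i. b i - M i x0 * l"] by blast
    have "(\<Sum>x\<in>insert x0 X. M i x * (r(x0 := l)) x) = M i x0 * l + (\<Sum>x\<in>X. M i x * r x)" for i
    proof -
      have "(\<Sum>x\<in>X. M i x * (r(x0 := l)) x) = (\<Sum>x\<in>X. M i x * r x)"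
        using insert.hyps by (intro sum.cong) auto
      then show ?thesis using insert.hyps by simp
    qed
    then show ?thesis using r by (intro exI[of _ "r(x0 := l)"]) simp
  qed
qed

lemma bit_sum_of_bool: "finite X \<Longrightarrow> (\<Sum>x\<in>X. of_bool (P x) :: bit) = of_bool (odd (card {x \<in> X. P x}))"
proof (induction X rule: finite_induct)
  case (insert a X)
  have "{x \<in> insert a X. P x} = (if P a then insert a {x \<in> X. P x} else {x \<in> X. P x})" by auto
  then show ?case using insert by (auto simp: card_insert_if)
qed simp

text \<open>
  The unknown is a subset \<open>R\<close> of \<open>X\<close>, with one equation for each fibre of \<open>p\<close> and of \<open>q\<close>. Every
  \<open>x\<close> lies in exactly one fibre of each kind, so a relation between the rows assigns the same
  coefficient to both: it is given by a set that is a union of fibres of \<open>p\<close> and also a union of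
  fibres of \<open>q\<close>. In graph terms, this is the existence of a \<open>T\<close>-join in the bipartite graph of
  fibres, with \<open>X\<close> as edge set.
\<close>

lemma two_partition_parity:
  fixes p :: "'x \<Rightarrow> 'a" and q :: "'x \<Rightarrow> 'b"
  assumes "finite X" "B \<subseteq> q ` X"
    and closed: "\<And>S. S \<subseteq> X \<Longrightarrow> (\<And>x y. x \<in> S \<Longrightarrow> y \<in> X \<Longrightarrow> p y = p x \<or> q y = q x \<Longrightarrow> y \<in> S) \<Longrightarrow>
      even (card (B \<inter> q ` S))"
  shows "\<exists>R. \<forall>x \<in> X. even (card {y \<in> X. p y = p x \<and> R y}) \<and>
    (odd (card {y \<in> X. q y = q x \<and> R y}) \<longleftrightarrow> q x \<in> B)"
proof -
  define I :: "('a + 'b) set" where "I = Inl ` p ` X \<union> Inr ` q ` X"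
  define M :: "'a + 'b \<Rightarrow> 'x \<Rightarrow> bit" where
    "M i x = (case i of Inl a \<Rightarrow> of_bool (p x = a) | Inr d \<Rightarrow> of_bool (q x = d))" for i x
  define b :: "'a + 'b \<Rightarrow> bit" where "b i = (case i of Inl a \<Rightarrow> 0 | Inr d \<Rightarrow> of_bool (d \<in> B))" for i
  have fin: "finite I" using assms(1) by (simp add: I_def)
  have split: "(\<Sum>i\<in>I. h i) = (\<Sum>a\<in>p ` X. h (Inl a)) + (\<Sum>d\<in>q ` X. h (Inr d))" for h :: "_ \<Rightarrow> bit"
    unfolding I_def using assms(1)
    by (subst sum.union_disjoint) (auto simp: sum.reindex inj_on_def)
  have "(\<Sum>i\<in>I. y i * b i) = 0" if y: "\<And>x. x \<in> X \<Longrightarrow> (\<Sum>i\<in>I. y i * M i x) = 0" for y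
  proof -
    have yx: "y (Inl (p x)) = y (Inr (q x))" if x: "x \<in> X" for x
    proof -
      have "(\<Sum>a\<in>p ` X. y (Inl a) * of_bool (p x = a)) = (\<Sum>a\<in>p ` X. if a = p x then y (Inl a) else 0)"
        "(\<Sum>d\<in>q ` X. y (Inr d) * of_bool (q x = d)) = (\<Sum>d\<in>q ` X. if d = q x then y (Inr d) else 0)"
        by (auto intro: sum.cong)
      then have "y (Inl (p x)) + y (Inr (q x)) = 0"
        using y[OF x] x assms(1) by (simp add: split M_def)
      then show ?thesis by (cases "y (Inl (p x))"; cases "y (Inr (q x))") auto
    qed
    define S where "S = {x \<in> X. y (Inr (q x)) = 1}"
    have "even (card (B \<inter> q ` S))"
    proof (rule closed)
      fix x z assume "x \<in> S" "z \<in> X" "p z = p x \<or> q z = q x"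
      then show "z \<in> S" using yx[of x] yx[of z] by (auto simp: S_def)
    qed (auto simp: S_def)
    moreover have "B \<inter> q ` S = {d \<in> q ` X. d \<in> B \<and> y (Inr d) = 1}" using assms(2) by (auto simp: S_def)
    ultimately have ev: "even (card {d \<in> q ` X. d \<in> B \<and> y (Inr d) = 1})" by simp
    have "y i * of_bool P = of_bool (P \<and> y i = 1)" for i P by (cases "y i") auto
    then have "(\<Sum>i\<in>I. y i * b i) = (\<Sum>d\<in>q ` X. of_bool (d \<in> B \<and> y (Inr d) = 1))"
      by (simp add: split b_def del: of_bool_conj)
    also have "\<dots> = of_bool (odd (card {d \<in> q ` X. d \<in> B \<and> y (Inr d) = 1}))"
      using assms(1) by (intro bit_sum_of_bool) simp
    finally show ?thesis using ev by simp
  qed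
  then obtain r where r: "\<And>i. i \<in> I \<Longrightarrow> (\<Sum>x\<in>X. M i x * r x) = b i"
    using fredholm_alternative[OF assms(1) fin, of M b] by blast
  have of: "of_bool P * r x = of_bool (P \<and> r x = 1)" for x P by (cases "r x") auto
  show ?thesis
  proof (intro exI[of _ "\<lambda>x. r x = 1"] ballI conjI)
    fix x assume x: "x \<in> X"
    have "(\<Sum>z\<in>X. of_bool (p z = p x) * r z) = 0"
      using r[of "Inl (p x)"] x by (simp add: I_def M_def b_def)
    then show "even (card {y \<in> X. p y = p x \<and> r y = 1})"
      unfolding of bit_sum_of_bool[OF assms(1)] by simp
    have "(\<Sum>z\<in>X. of_bool (q z = q x) * r z) = of_bool (q x \<in> B)"
      using r[of "Inr (q x)"] x by (simp add: I_def M_def b_def)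
    then show "odd (card {y \<in> X. q y = q x \<and> r y = 1}) \<longleftrightarrow> q x \<in> B"
      unfolding of bit_sum_of_bool[OF assms(1)] by (simp only: of_bool_eq_iff)
  qed
qed

lemma even_card_involution:
  assumes "finite S" "\<And>x. x \<in> S \<Longrightarrow> t x \<in> S" "\<And>x. x \<in> S \<Longrightarrow> t (t x) = x" "\<And>x. x \<in> S \<Longrightarrow> t x \<noteq> x"
  shows "even (card S)"
proof -
  let ?C = "(\<lambda>x. {x, t x}) ` S"
  have "2 * card ?C = card (\<Union> ?C)"
  proof (rule card_partition)
    show "finite ?C" "finite (\<Union> ?C)" using assms(1) by auto
    show "card c = 2" if "c \<in> ?C" for c
    proof -
      obtain x where "x \<in> S" "c = {x, t x}" using \<open>c \<in> ?C\<close> by blast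
      then show ?thesis using assms(4)[of x] by (auto simp: card_insert_if)
    qed
    show "c \<inter> c' = {}" if cc: "c \<in> ?C" "c' \<in> ?C" "c \<noteq> c'" for c c'
    proof -
      have "d = {z, t z}" if "d \<in> ?C" "z \<in> d" for d z
      proof -
        obtain x where "x \<in> S" "d = {x, t x}" using \<open>d \<in> ?C\<close> by blast
        moreover from this have "z = x \<or> z = t x" using \<open>z \<in> d\<close> by simp
        ultimately show ?thesis using assms(3)[of x] by (elim disjE) (simp_all add: insert_commute)
      qed
      then show ?thesis using cc by blast
    qed
  qed
  moreover have "\<Union> ?C = S" using assms(2) by auto
  ultimately show ?thesis by (metis dvd_triv_left)
qed


section \<open>Degrees and colourings in terms of flags\<close>

lemma orbit_under_refl: "x \<in> orbit_under T x"
  by (simp add: orbit_under_def)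

lemma orbit_under_step: "t \<in> T \<Longrightarrow> t x \<in> orbit_under T x"
  unfolding orbit_under_def by auto

lemma orbit_under_trans: "y \<in> orbit_under T x \<Longrightarrow> orbit_under T y \<subseteq> orbit_under T x"
  unfolding orbit_under_def by auto

lemma orbit_under_involution_eq:
  assumes "t \<in> T" "t (t x) = x"
  shows "orbit_under T (t x) = orbit_under T x"
  using orbit_under_trans[OF orbit_under_step[OF assms(1)], of x]
    orbit_under_trans[OF orbit_under_step[OF assms(1), of "t x"]] assms(2) by auto

text \<open>
  Working with arbitrary unions of vertices, rather than with single vertices, spares the reference
  to orbits: these are the sets closed under two involutions.
\<close>

definition vertex_union :: "('f, 'e, 'd) arrow_ribbon \<Rightarrow> 'f set \<Rightarrow> bool" where
  "vertex_union G S \<longleftrightarrow> S \<subseteq> flags G \<and> (\<forall>x \<in> S. corner_map G x \<in> S \<and> arc_map G x \<in> S)"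

text \<open>
  An arc has two flags, so divisibility by 4 means that an even number of arcs of edges in \<open>A\<close> lies on
  the vertices in question.
\<close>

definition even_at_vertices :: "('f, 'e, 'd) arrow_ribbon \<Rightarrow> 'e set \<Rightarrow> bool" where
  "even_at_vertices G A \<longleftrightarrow> (\<forall>S. vertex_union G S \<longrightarrow> 4 dvd card {x \<in> S. label G x \<in> A})"

lemma vertex_at_corner_arc:
  assumes "ribbon_graph G" "x \<in> flags G"
  shows "vertex_at G (corner_map G x) = vertex_at G x" "vertex_at G (arc_map G x) = vertex_at G x"
proof -
  note f = ribbon_graph_flagD(4,7)[OF assms]
  show "vertex_at G (corner_map G x) = vertex_at G x"
    unfolding vertex_at_def using f by (subst orbit_under_involution_eq) auto
  show "vertex_at G (arc_map G x) = vertex_at G x"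
    unfolding vertex_at_def using f by (subst orbit_under_involution_eq) auto
qed

lemma vertex_union_vertex:
  assumes "ribbon_graph G"
  shows "vertex_union G {x \<in> flags G. vertex_at G x = v}"
  using vertex_at_corner_arc[OF assms] ribbon_graph_flagD(2,5)[OF assms]
  by (simp add: vertex_union_def)

lemma vertex_union_vertex_at:
  assumes "vertex_union G S" "x \<in> S" "vertex_at G y = vertex_at G x"
  shows "y \<in> S"
proof -
  have "orbit_under {corner_map G, arc_map G} x \<subseteq> S"
    using assms(1,2) by (intro orbit_under_subset) (auto simp: vertex_union_def)
  moreover have "orbit_under {corner_map G, arc_map G} y = orbit_under {corner_map G, arc_map G} x"
    using assms(3) by (simp add: vertex_at_def)
  then have "y \<in> orbit_under {corner_map G, arc_map G} x" using orbit_under_refl by metis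
  ultimately show ?thesis by blast
qed

lemma ribbon_graph_finite:
  assumes "ribbon_graph G"
  shows "finite (flags G)" "finite (edges G)" "label G ` flags G = edges G"
proof -
  have f: "finite (flags G)" and l: "label G ` flags G \<subseteq> edges G"
    and c: "\<And>e. e \<in> edges G \<Longrightarrow> card {x \<in> flags G. label G x = e} = 4"
    using assms by (auto simp: ribbon_graph_def arrow_ribbon_graph_def)
  have "e \<in> label G ` flags G" if "e \<in> edges G" for e
  proof -
    have "{x \<in> flags G. label G x = e} \<noteq> {}" using c[OF that] by (metis card.empty zero_neq_numeral)
    then show ?thesis by auto
  qed
  then show "label G ` flags G = edges G" using l by auto
  then show "finite (flags G)" "finite (edges G)" using f by (auto dest: sym)
qed

lemma edge_flagE:
  assumes "ribbon_graph G" "e \<in> edges G"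
  obtains x where "x \<in> flags G" "label G x = e"
proof -
  have "e \<in> label G ` flags G" using assms(2) ribbon_graph_finite(3)[OF assms(1)] by simp
  then show thesis using that by auto
qed

lemma ends_underlying:
  assumes G: "ribbon_graph G" and x: "x \<in> flags G"
  shows "ends (underlying G) (label G x) = {#vertex_at G x, vertex_at G (side_map G x)#}"
proof -
  note f = ribbon_graph_flagD[OF G x]
  note ef = edge_flags[OF G x]
  let ?s = "side_map G x"
  note fs = ribbon_graph_flagD[OF G f(8)]
  have arcs: "arcs_of G (label G x) = {{x, arc_map G x}, {?s, arc_map G ?s}}"
    unfolding arcs_of_def ef(1) using f(4) fs(4) by (simp add: insert_commute)
  have "x \<notin> {?s, arc_map G ?s}" using f ef(2) by auto
  then have ne: "{x, arc_map G x} \<noteq> {?s, arc_map G ?s}" by blast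
  have "vertex_at G ` {x, arc_map G x} = {vertex_at G x}"
    "vertex_at G ` {?s, arc_map G ?s} = {vertex_at G ?s}"
    using vertex_at_corner_arc[OF G x] vertex_at_corner_arc[OF G f(8)] by auto
  then show ?thesis
    using ne by (simp add: underlying_def arcs)
qed

lemma finite_multigraph_underlying:
  assumes "ribbon_graph G"
  shows "finite_multigraph (underlying G)"
proof -
  have "size (ends (underlying G) e) = 2 \<and> set_mset (ends (underlying G) e) \<subseteq> vertices G"
    if e: "e \<in> edges G" for e
  proof -
    obtain x where x: "x \<in> flags G" "label G x = e" using edge_flagE[OF assms e] .
    show ?thesis
      using ends_underlying[OF assms x(1)] x ribbon_graph_flagD(8)[OF assms x(1)]
      by (simp add: vertices_def)
  qed
  then show ?thesis
    using ribbon_graph_finite(2)[OF assms] by (simp add: finite_multigraph_def) (simp add: underlying_def)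
qed

lemma flags_at_vertex:
  assumes G: "ribbon_graph G" and A: "A \<subseteq> edges G"
  shows "card {x \<in> flags G. label G x \<in> A \<and> vertex_at G x = v} =
    2 * (\<Sum>e \<in> A. count (ends (underlying G) e) v)"
proof -
  have fin: "finite A" using A ribbon_graph_finite(2)[OF G] finite_subset by blast
  have edge: "card {x \<in> flags G. label G x = e \<and> vertex_at G x = v} =
      2 * count (ends (underlying G) e) v" if e: "e \<in> A" for e
  proof -
    obtain x where x: "x \<in> flags G" "label G x = e"
      using edge_flagE[OF G, of e] e A by blast
    let ?s = "side_map G x"
    note f = ribbon_graph_flagD[OF G x(1)]
    note ef = edge_flags[OF G x(1)]
    note fs = ribbon_graph_flagD[OF G f(8)]
    have "{y \<in> flags G. label G y = e \<and> vertex_at G y = v} =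
        {y \<in> {y \<in> flags G. label G y = label G x}. vertex_at G y = v}"
      using x by auto
    also have "\<dots> = {y \<in> {x, arc_map G x} \<union> {?s, arc_map G ?s}. vertex_at G y = v}"
      unfolding ef(1) by auto
    also have "\<dots> = (if vertex_at G x = v then {x, arc_map G x} else {}) \<union>
        (if vertex_at G ?s = v then {?s, arc_map G ?s} else {})"
      using vertex_at_corner_arc[OF G x(1)] vertex_at_corner_arc[OF G f(8)] by auto
    also have "card \<dots> = card (if vertex_at G x = v then {x, arc_map G x} else {}) +
        card (if vertex_at G ?s = v then {?s, arc_map G ?s} else {})"
      using f(3,9,13) ef(2) by (intro card_Un_disjoint) auto
    also have "\<dots> = 2 * count {#vertex_at G x, vertex_at G ?s#} v"
      using f(3) fs(3) by (simp add: card_insert_if)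
    finally show ?thesis using ends_underlying[OF G x(1)] x(2) by simp
  qed
  have "{x \<in> flags G. label G x \<in> A \<and> vertex_at G x = v} =
      (\<Union>e\<in>A. {x \<in> flags G. label G x = e \<and> vertex_at G x = v})" by auto
  also have "card \<dots> = (\<Sum>e\<in>A. card {x \<in> flags G. label G x = e \<and> vertex_at G x = v})"
    using fin ribbon_graph_finite(1)[OF G] by (intro card_UN_disjoint) auto
  finally show ?thesis using edge by (simp add: sum_distrib_left)
qed

lemma even_degrees_iff_even_at_vertices:
  assumes G: "ribbon_graph G" and A: "A \<subseteq> edges G"
  shows "(\<forall>v. even (\<Sum>e \<in> A. count (ends (underlying G) e) v)) \<longleftrightarrow> even_at_vertices G A"
proof
  assume ev: "\<forall>v. even (\<Sum>e \<in> A. count (ends (underlying G) e) v)"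
  show "even_at_vertices G A"
    unfolding even_at_vertices_def
  proof (intro allI impI)
    fix S assume S: "vertex_union G S"
    have sub: "S \<subseteq> flags G" using S by (simp add: vertex_union_def)
    then have fin: "finite S" using ribbon_graph_finite(1)[OF G] finite_subset by blast
    have "{x \<in> S. label G x \<in> A} =
        (\<Union>v \<in> vertex_at G ` S. {x \<in> flags G. label G x \<in> A \<and> vertex_at G x = v})"
      using sub vertex_union_vertex_at[OF S] by fastforce
    also have "card \<dots> = (\<Sum>v \<in> vertex_at G ` S. card {x \<in> flags G. label G x \<in> A \<and> vertex_at G x = v})"
      using fin ribbon_graph_finite(1)[OF G] by (intro card_UN_disjoint) auto
    also have "4 dvd \<dots>"
    proof (rule dvd_sum)
      fix v
      obtain k where "(\<Sum>e \<in> A. count (ends (underlying G) e) v) = 2 * k" using ev by (meson evenE)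
      then show "4 dvd card {x \<in> flags G. label G x \<in> A \<and> vertex_at G x = v}"
        unfolding flags_at_vertex[OF G A] by simp
    qed
    finally show "4 dvd card {x \<in> S. label G x \<in> A}" .
  qed
next
  assume ev: "even_at_vertices G A"
  show "\<forall>v. even (\<Sum>e \<in> A. count (ends (underlying G) e) v)"
  proof
    fix v
    have "4 dvd card {x \<in> {x \<in> flags G. vertex_at G x = v}. label G x \<in> A}"
      using ev vertex_union_vertex[OF G] unfolding even_at_vertices_def by blast
    moreover have "{x \<in> {x \<in> flags G. vertex_at G x = v}. label G x \<in> A} =
        {x \<in> flags G. label G x \<in> A \<and> vertex_at G x = v}" by auto
    ultimately have "4 dvd 2 * (\<Sum>e \<in> A. count (ends (underlying G) e) v)"
      using flags_at_vertex[OF G A] by simp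
    then show "even (\<Sum>e \<in> A. count (ends (underlying G) e) v)" by presburger
  qed
qed

lemma components_eulerian_iff_even_at_vertices:
  assumes G: "ribbon_graph G" and A: "A \<subseteq> edges G"
  shows "(\<forall>K \<in> mcomponents (edge_induced (underlying G) A). eulerian K) \<longleftrightarrow> even_at_vertices G A"
proof -
  have "A \<subseteq> medges (underlying G)" using A by (simp add: underlying_def)
  then show ?thesis
    using components_edge_induced_eulerian_iff[OF finite_multigraph_underlying[OF G]]
      even_degrees_iff_even_at_vertices[OF G A] by simp
qed

lemma eulerian_iff_even_at_vertices:
  assumes G: "ribbon_graph G"
  shows "eulerian (underlying G) \<longleftrightarrow> mconnected (underlying G) \<and> even_at_vertices G (edges G)"
proof -
  have deg: "mdegree (underlying G) v = (\<Sum>e \<in> edges G. count (ends (underlying G) e) v)" for v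
    by (simp add: mdegree_def) (simp add: underlying_def)
  have "mdegree (underlying G) v = 0" if v: "v \<notin> mverts (underlying G)" for v
    unfolding mdegree_def
  proof (rule sum.neutral, rule ballI)
    fix e assume "e \<in> medges (underlying G)"
    then have "set_mset (ends (underlying G) e) \<subseteq> mverts (underlying G)"
      using finite_multigraph_underlying[OF G] by (simp add: finite_multigraph_def)
    then show "count (ends (underlying G) e) v = 0" using v by (auto simp: count_eq_zero_iff)
  qed
  then have "(\<forall>v \<in> mverts (underlying G). even (mdegree (underlying G) v)) \<longleftrightarrow>
      (\<forall>v. even (mdegree (underlying G) v))"
    by (metis even_zero)
  then show ?thesis
    using eulerian_iff_even_degrees[OF finite_multigraph_underlying[OF G]]
      even_degrees_iff_even_at_vertices[OF G order_refl] by (simp add: deg)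
qed

text \<open>
  A colouring of the vertices is a colouring of the flags that is invariant under corners and arcs;
  the two ends of an edge are joined by a free side.
\<close>

lemma bipartite_edge_induced_iff:
  assumes G: "ribbon_graph G" and A: "A \<subseteq> edges G"
  shows "bipartite (edge_induced (underlying G) A) \<longleftrightarrow>
    (\<exists>f. \<forall>x \<in> flags G. f (corner_map G x) = f x \<and> f (arc_map G x) = f x \<and>
       (label G x \<in> A \<longrightarrow> f (side_map G x) \<noteq> (f x :: bool)))"
    (is "?L \<longleftrightarrow> (\<exists>f. ?P f)")
proof
  assume ?L
  then obtain c :: "'a set + 'c \<Rightarrow> bool" where c0:
    "\<forall>e \<in> medges (edge_induced (underlying G) A). \<forall>u v.
       ends (edge_induced (underlying G) A) e = {#u, v#} \<longrightarrow> c u \<noteq> c v"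
    unfolding bipartite_def ..
  have c: "c u \<noteq> c v" if "e \<in> A" "ends (underlying G) e = {#u, v#}" for e u v
    using c0[rule_format, of e u v] that by (simp add: edge_induced_def)
  have "?P (\<lambda>x. c (vertex_at G x))"
  proof (intro ballI conjI impI)
    fix x assume x: "x \<in> flags G"
    show "c (vertex_at G (corner_map G x)) = c (vertex_at G x)"
      "c (vertex_at G (arc_map G x)) = c (vertex_at G x)"
      using vertex_at_corner_arc[OF G x] by simp_all
    show "c (vertex_at G (side_map G x)) \<noteq> c (vertex_at G x)" if "label G x \<in> A"
      using c[OF that ends_underlying[OF G x]] by simp
  qed
  then show "\<exists>f. ?P f" by (intro exI[of _ "\<lambda>x. c (vertex_at G x)"])
next
  assume "\<exists>f. ?P f"
  then obtain f where f: "?P f" ..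
  define c where "c v \<longleftrightarrow> (\<exists>x \<in> flags G. vertex_at G x = v \<and> f x)" for v
  have const: "f y = f x" if "x \<in> flags G" "y \<in> flags G" "vertex_at G y = vertex_at G x" for x y
  proof -
    have "vertex_union G {z \<in> flags G. f z = f x}"
      using f ribbon_graph_flagD(2,5)[OF G] by (simp add: vertex_union_def)
    then show ?thesis using vertex_union_vertex_at[OF _ _ that(3)] that(1) by blast
  qed
  have c: "c (vertex_at G x) = f x" if "x \<in> flags G" for x
    using const that unfolding c_def by metis
  have "c u \<noteq> c v" if e: "e \<in> A" "ends (underlying G) e = {#u, v#}" for e u v
  proof -
    obtain x where x: "x \<in> flags G" "label G x = e"
      using edge_flagE[OF G, of e] e A by blast
    then have "{#vertex_at G x, vertex_at G (side_map G x)#} = {#u, v#}"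
      using ends_underlying[OF G x(1)] e by simp
    then have "{u, v} = {vertex_at G x, vertex_at G (side_map G x)}"
      by (metis set_mset_add_mset_insert set_mset_empty)
    moreover have "c (vertex_at G x) \<noteq> c (vertex_at G (side_map G x))"
      using c[OF x(1)] c[OF ribbon_graph_flagD(8)[OF G x(1)]] f x e by auto
    moreover have "u = vertex_at G x \<and> v = vertex_at G (side_map G x) \<or>
        v = vertex_at G x \<and> u = vertex_at G (side_map G x)"
      using calculation by (auto simp: doubleton_eq_iff)
    ultimately show ?thesis by auto
  qed
  then show ?L by (auto simp: bipartite_def edge_induced_def)
qed

lemma bipartite_underlying_iff:
  assumes G: "ribbon_graph G"
  shows "bipartite (underlying G) \<longleftrightarrow>
    (\<exists>f. \<forall>x \<in> flags G. f (corner_map G x) = f x \<and> f (arc_map G x) = f x \<and>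
       f (side_map G x) \<noteq> (f x :: bool))"
proof -
  have "bipartite (underlying G) \<longleftrightarrow> bipartite (edge_induced (underlying G) (edges G))"
    by (simp add: bipartite_def edge_induced_def underlying_def)
  then show ?thesis
    using bipartite_edge_induced_iff[OF G order_refl] ribbon_graph_flagD(1)[OF G] by simp
qed

lemma mconnected_underlying:
  assumes G: "ribbon_graph G" and ne: "flags G \<noteq> {}" and bare: "bare G = {}"
    and conn: "\<And>S. S \<subseteq> flags G \<Longrightarrow> S \<noteq> {} \<Longrightarrow>
      (\<And>x. x \<in> S \<Longrightarrow> corner_map G x \<in> S \<and> arc_map G x \<in> S \<and> side_map G x \<in> S) \<Longrightarrow> S = flags G"
  shows "mconnected (underlying G)"
proof -
  have mv: "mverts (underlying G) = vertex_at G ` flags G"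
    using bare by (simp add: underlying_def vertices_def)
  have "\<exists>es. walk (underlying G) (vertex_at G x) es (vertex_at G y)"
    if xy: "x \<in> flags G" "y \<in> flags G" for x y
  proof -
    define S where "S = {z \<in> flags G. \<exists>es. walk (underlying G) (vertex_at G x) es (vertex_at G z)}"
    have "walk (underlying G) (vertex_at G x) [] (vertex_at G x)" using xy mv by simp
    then have xS: "x \<in> S" unfolding S_def using xy by blast
    have "S = flags G"
    proof (rule conn)
      fix z assume z: "z \<in> S"
      then obtain es where es: "z \<in> flags G" "walk (underlying G) (vertex_at G x) es (vertex_at G z)"
        by (auto simp: S_def)
      note f = ribbon_graph_flagD[OF G es(1)]
      have "walk (underlying G) (vertex_at G z) [label G z] (vertex_at G (side_map G z))"
        using f(1) f(8) es(1) ends_underlying[OF G es(1)] mv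
        by (intro walk_edge) (auto simp: underlying_def)
      then have "walk (underlying G) (vertex_at G x) (es @ [label G z]) (vertex_at G (side_map G z))"
        by (rule walk_appendI[OF es(2)])
      then show "corner_map G z \<in> S \<and> arc_map G z \<in> S \<and> side_map G z \<in> S"
        using f(2,5,8) es vertex_at_corner_arc[OF G es(1)] unfolding S_def by auto
    qed (use xS in \<open>auto simp: S_def\<close>)
    then show ?thesis using xy by (auto simp: S_def)
  qed
  then show ?thesis using ne by (auto simp: mconnected_def mv)
qed

text \<open>
  Inside a union of vertices, the flags of one colour \<open>f\<close> are paired up by corners, and those not on
  \<open>A\<close> also by arcs. So an even number of them lies on \<open>A\<close>; each arc of \<open>A\<close> has one flag of each
  colour.
\<close>

lemma colouring_imp_even_at_vertices:
  assumes G: "ribbon_graph G" and A: "A \<subseteq> edges G"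
    and f: "\<And>x. x \<in> flags G \<Longrightarrow> f (corner_map G x) = f x \<and> (f (arc_map G x) \<noteq> (f x :: bool) \<longleftrightarrow> label G x \<in> A)"
  shows "even_at_vertices G A"
  unfolding even_at_vertices_def
proof (intro allI impI)
  fix S assume S: "vertex_union G S"
  then have sub: "S \<subseteq> flags G" and cl: "\<And>x. x \<in> S \<Longrightarrow> corner_map G x \<in> S" "\<And>x. x \<in> S \<Longrightarrow> arc_map G x \<in> S"
    by (auto simp: vertex_union_def)
  have fin: "finite S" using sub ribbon_graph_finite(1)[OF G] finite_subset by blast
  have inF: "x \<in> flags G" if "x \<in> S" for x using that sub by blast
  note fl = ribbon_graph_flagD[OF G inF]
  have fS: "f (corner_map G x) = f x" "label G x \<in> A \<Longrightarrow> f (arc_map G x) = (\<not> f x)"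
    "label G x \<notin> A \<Longrightarrow> f (arc_map G x) = f x" if "x \<in> S" for x
    using f[OF inF[OF that]] by auto
  let ?T = "{x \<in> S. f x}" and ?A = "{x \<in> S. label G x \<in> A \<and> f x}" and ?A' = "{x \<in> S. label G x \<in> A \<and> \<not> f x}"
  have "even (card ?T)"
    by (rule even_card_involution[where t = "corner_map G"])
      (use fin cl fl fS in auto)
  moreover have "even (card {x \<in> S. label G x \<notin> A \<and> f x})"
    by (rule even_card_involution[where t = "arc_map G"])
      (use fin cl fl fS in auto)
  moreover have "card ?T = card ?A + card {x \<in> S. label G x \<notin> A \<and> f x}"
    using fin by (subst card_Un_disjoint[symmetric]) (auto intro: arg_cong[of _ _ card])
  ultimately have "even (card ?A)" by simp
  moreover have "card ?A' = card ?A"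
  proof (rule bij_betw_same_card[of "arc_map G"], rule bij_betwI[where g = "arc_map G"])
    show "arc_map G \<in> ?A' \<rightarrow> ?A" using cl fl fS by auto
    show "arc_map G \<in> ?A \<rightarrow> ?A'" using cl fl fS by auto
  qed (use fl in auto)
  moreover have "card {x \<in> S. label G x \<in> A} = card ?A + card ?A'"
    using fin by (subst card_Un_disjoint[symmetric]) (auto intro: arg_cong[of _ _ card])
  ultimately show "4 dvd card {x \<in> S. label G x \<in> A}" by presburger
qed

lemma card_filter_pair: "b \<noteq> a \<Longrightarrow> card {y \<in> {a, b}. R y} = of_bool (R a) + of_bool (R b)"
proof -
  assume "b \<noteq> a"
  have "{y \<in> {a, b}. R y} = (if R a then {a} else {}) \<union> (if R b then {b} else {})" by auto
  then show ?thesis using \<open>b \<noteq> a\<close> by simp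
qed

lemma even_card_image_of_pairs:
  assumes "finite S" "\<And>x. x \<in> S \<Longrightarrow> card {y \<in> S. q y = q x} = 2" "4 dvd card S"
  shows "even (card (q ` S))"
proof -
  have "S = (\<Union>d \<in> q ` S. {y \<in> S. q y = d})" by auto
  then have "card S = card (\<Union>d \<in> q ` S. {y \<in> S. q y = d})" by simp
  also have "\<dots> = (\<Sum>d \<in> q ` S. card {y \<in> S. q y = d})"
    using assms(1) by (intro card_UN_disjoint) auto
  also have "\<dots> = (\<Sum>d \<in> q ` S. 2)" using assms(2) by (intro sum.cong) auto
  finally have "2 * 2 dvd 2 * card (q ` S)" using assms(3) by simp
  then show ?thesis by (simp only: dvd_times_left_cancel_iff)
qed

text \<open>
  The converse: even degrees are exactly what is needed to solve the colouring problem around each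
  vertex. The fibres in \<open>two_partition_parity\<close> are the corner pairs and the arc pairs.
\<close>

lemma even_at_vertices_imp_colouring:
  assumes G: "ribbon_graph G" and ev: "even_at_vertices G A"
  shows "\<exists>P. \<forall>x \<in> flags G. P (corner_map G x) = P x \<and> (P (arc_map G x) \<noteq> (P x :: bool) \<longleftrightarrow> label G x \<in> A)"
proof -
  note fl = ribbon_graph_flagD[OF G]
  have fin: "finite (flags G)" using ribbon_graph_finite[OF G] by blast
  define p where "p x = {x, corner_map G x}" for x
  define q where "q x = {x, arc_map G x}" for x
  define B where "B = q ` {x \<in> flags G. label G x \<in> A}"
  have p: "p y = p x \<longleftrightarrow> y \<in> {x, corner_map G x}" if "x \<in> flags G" "y \<in> flags G" for x y
    using fl(7)[OF that(1)] fl(7)[OF that(2)] by (auto simp: p_def doubleton_eq_iff)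
  have q: "q y = q x \<longleftrightarrow> y \<in> {x, arc_map G x}" if "x \<in> flags G" "y \<in> flags G" for x y
    using fl(4)[OF that(1)] fl(4)[OF that(2)] by (auto simp: q_def doubleton_eq_iff)
  have qB: "q x \<in> B \<longleftrightarrow> label G x \<in> A" if x: "x \<in> flags G" for x
  proof
    assume "q x \<in> B"
    then obtain y where y: "y \<in> flags G" "label G y \<in> A" "q x = q y" by (auto simp: B_def)
    then show "label G x \<in> A" using q[OF y(1) x] fl(11)[OF y(1)] by auto
  qed (use x in \<open>auto simp: B_def\<close>)
  have "\<exists>R. \<forall>x \<in> flags G. even (card {y \<in> flags G. p y = p x \<and> R y}) \<and>
    (odd (card {y \<in> flags G. q y = q x \<and> R y}) \<longleftrightarrow> q x \<in> B)"
  proof (rule two_partition_parity[OF fin])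
    show "B \<subseteq> q ` flags G" by (auto simp: B_def)
    fix S assume S: "S \<subseteq> flags G"
      and cl: "\<And>x y. x \<in> S \<Longrightarrow> y \<in> flags G \<Longrightarrow> p y = p x \<or> q y = q x \<Longrightarrow> y \<in> S"
    have inF: "x \<in> flags G" if "x \<in> S" for x using that S by blast
    have clS: "corner_map G x \<in> S" "arc_map G x \<in> S" if "x \<in> S" for x
      using cl[OF that, of "corner_map G x"] cl[OF that, of "arc_map G x"] fl(2,5)[OF inF[OF that]]
        p[OF inF[OF that], of "corner_map G x"] q[OF inF[OF that], of "arc_map G x"] by auto
    let ?A = "{x \<in> S. label G x \<in> A}"
    have "B \<inter> q ` S = q ` ?A" using qB[OF inF] by (auto simp: B_def)
    moreover have "even (card (q ` ?A))"
    proof (rule even_card_image_of_pairs)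
      show "finite ?A" using finite_subset[OF S fin] by simp
      show "4 dvd card ?A" using ev clS S by (auto simp: even_at_vertices_def vertex_union_def)
      fix x assume x: "x \<in> ?A"
      then have "{y \<in> ?A. q y = q x} = {x, arc_map G x}"
        using q[OF inF inF] clS fl(11)[OF inF] by auto
      moreover have "arc_map G x \<noteq> x" using x fl(3)[OF inF[of x]] by simp
      ultimately show "card {y \<in> ?A. q y = q x} = 2" by (auto simp: card_insert_if)
    qed
    ultimately show "even (card (B \<inter> q ` S))" by simp
  qed
  then obtain R where R: "\<And>x. x \<in> flags G \<Longrightarrow> even (card {y \<in> flags G. p y = p x \<and> R y})"
    "\<And>x. x \<in> flags G \<Longrightarrow> odd (card {y \<in> flags G. q y = q x \<and> R y}) \<longleftrightarrow> q x \<in> B"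
    by blast
  show ?thesis
  proof (intro exI[of _ R] ballI)
    fix x assume x: "x \<in> flags G"
    have "{y \<in> flags G. p y = p x \<and> R y} = {y \<in> {x, corner_map G x}. R y}"
      "{y \<in> flags G. q y = q x \<and> R y} = {y \<in> {x, arc_map G x}. R y}"
      using p[OF x] q[OF x] x fl(2,5)[OF x] by auto
    then have "card {y \<in> flags G. p y = p x \<and> R y} = of_bool (R x) + of_bool (R (corner_map G x))"
      "card {y \<in> flags G. q y = q x \<and> R y} = of_bool (R x) + of_bool (R (arc_map G x))"
      using fl(3,6)[OF x] by (simp_all only: card_filter_pair not_False_eq_True)
    then show "R (corner_map G x) = R x \<and> (R (arc_map G x) \<noteq> R x \<longleftrightarrow> label G x \<in> A)"
      using R[OF x] qB[OF x] by (auto simp: of_bool_def split: if_splits)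
  qed
qed

text \<open>
  The four flags of an edge form a 4-cycle in which arcs and sides alternate, so changes along both
  arcs and changes along both sides can be prescribed independently.
\<close>

lemma edge_colouring_exists:
  assumes G: "ribbon_graph G"
  shows "\<exists>Q. \<forall>x \<in> flags G. (Q (arc_map G x) \<noteq> (Q x :: bool) \<longleftrightarrow> label G x \<in> E1) \<and>
    (Q (side_map G x) \<noteq> Q x \<longleftrightarrow> label G x \<in> E2)"
proof -
  define r where "r e = (SOME x. x \<in> flags G \<and> label G x = e)" for e
  define Q where "Q x \<longleftrightarrow> (label G x \<in> E1 \<and> x \<in> {arc_map G (r (label G x)), arc_map G (side_map G (r (label G x)))})
    \<noteq> (label G x \<in> E2 \<and> x \<in> {side_map G (r (label G x)), arc_map G (side_map G (r (label G x)))})" for x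
  have "(Q (arc_map G x) \<noteq> Q x \<longleftrightarrow> label G x \<in> E1) \<and> (Q (side_map G x) \<noteq> Q x \<longleftrightarrow> label G x \<in> E2)"
    if x: "x \<in> flags G" for x
  proof -
    define y where "y = r (label G x)"
    have y: "y \<in> flags G" "label G y = label G x"
      unfolding y_def r_def using someI[of "\<lambda>z. z \<in> flags G \<and> label G z = label G x" x] x by auto
    let ?a = "arc_map G y" and ?s = "side_map G y" and ?o = "arc_map G (side_map G y)"
    note g = ribbon_graph_flagD[OF G y(1)]
    note gs = ribbon_graph_flagD[OF G g(8)]
    note ga = ribbon_graph_flagD[OF G g(2)]
    note ey = edge_flags[OF G y(1)]
    have dist: "y \<noteq> ?a" "y \<noteq> ?s" "y \<noteq> ?o" "?a \<noteq> ?s" "?a \<noteq> ?o" "?s \<noteq> ?o"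
      using g(3,9,13) ey(2) by auto
    have maps: "arc_map G ?a = y" "side_map G ?a = ?o" "side_map G ?s = y" "arc_map G ?o = ?s" "side_map G ?o = ?a"
      using g(4,10) ey(3) gs(4) ga(10) by auto
    have Q: "Q z \<longleftrightarrow> (label G x \<in> E1 \<and> z \<in> {?a, ?o}) \<noteq> (label G x \<in> E2 \<and> z \<in> {?s, ?o})"
      if "label G z = label G x" for z
      using that by (simp add: Q_def y_def)
    have "x \<in> {y, ?a, ?s, ?o}" using ey(1) x y by auto
    moreover have "label G (arc_map G x) = label G x" "label G (side_map G x) = label G x"
      using ribbon_graph_flagD(11,12)[OF G x] by auto
    moreover note dist dist[symmetric]
    ultimately show ?thesis
      using Q[of x] Q[of "arc_map G x"] Q[of "side_map G x"]
      by (elim insertE emptyE; cases "label G x \<in> E1"; cases "label G x \<in> E2")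
        (simp_all add: maps)
  qed
  then show ?thesis by blast
qed

text \<open>
  Even degrees in the partial dual, expressed by the flags of \<open>G\<close>. Unlike \<open>even_at_vertices\<close> for the
  partial dual, this form is visibly symmetric under passing to \<open>dual G\<close> and \<open>edges G - A\<close>.
\<close>

definition mixed_vertices_even :: "('f, 'e, 'd) arrow_ribbon \<Rightarrow> 'e set \<Rightarrow> bool" where
  "mixed_vertices_even G A \<longleftrightarrow>
     (\<forall>S \<subseteq> flags G. (\<forall>x \<in> S. corner_map G x \<in> S \<and> (if label G x \<in> A then side_map G x else arc_map G x) \<in> S)
        \<longrightarrow> 4 dvd card S)"

text \<open>
  This solves the colouring problem around the faces. The changes along the sides of edges outside \<open>A\<close>
  are free, except that the two sides of an edge must agree, i.e. the number of coloured flags on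
  the edge is even. So the fibres of \<open>q\<close> in \<open>two_partition_parity\<close> are the side pairs on \<open>A\<close> and
  whole edges outside \<open>A\<close>. A set \<open>S\<close> that obeys both partitions is a union of vertices of the partial
  dual and contains four flags of each of its edges outside \<open>A\<close>, so the number of its flags on \<open>A\<close> is
  divisible by 4.
\<close>

lemma mixed_vertices_even_imp_colouring:
  assumes G: "ribbon_graph G" and ev: "mixed_vertices_even G A"
  shows "\<exists>R. \<forall>x \<in> flags G. R (corner_map G x) = R x \<and>
    (label G x \<in> A \<longrightarrow> R (side_map G x) \<noteq> (R x :: bool)) \<and>
    (R (side_map G (arc_map G x)) \<noteq> R (arc_map G x) \<longleftrightarrow> R (side_map G x) \<noteq> R x)"
proof -
  note fl = ribbon_graph_flagD[OF G]
  have fin: "finite (flags G)" using ribbon_graph_finite[OF G] by blast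
  define p where "p x = {x, corner_map G x}" for x
  define q where "q x = (if label G x \<in> A then {x, side_map G x} else {y \<in> flags G. label G y = label G x})" for x
  define B where "B = q ` {x \<in> flags G. label G x \<in> A}"
  have p: "p y = p x \<longleftrightarrow> y \<in> {x, corner_map G x}" if "x \<in> flags G" "y \<in> flags G" for x y
    using fl(7)[OF that(1)] fl(7)[OF that(2)] by (auto simp: p_def doubleton_eq_iff)
  have q_self: "x \<in> q x" if "x \<in> flags G" for x using that by (auto simp: q_def)
  have q_sub: "q x \<subseteq> flags G" if "x \<in> flags G" for x using that fl(8) by (auto simp: q_def)
  have q_label: "label G y = label G x" if "x \<in> flags G" "y \<in> q x" for x y
    using that fl(12) by (auto simp: q_def split: if_splits)
  have q_eq: "q y = q x" if "x \<in> flags G" "y \<in> q x" for x y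
    using q_label[OF that] that fl(10)[of x] by (auto simp: q_def split: if_splits)
  have q: "q y = q x \<longleftrightarrow> y \<in> q x" if "x \<in> flags G" "y \<in> flags G" for x y
    using q_eq[of x y] q_self[OF that(2)] that by auto
  have qB: "q x \<in> B \<longleftrightarrow> label G x \<in> A" if x: "x \<in> flags G" for x
  proof
    assume "q x \<in> B"
    then obtain y where y: "y \<in> flags G" "label G y \<in> A" "q x = q y" by (auto simp: B_def)
    then show "label G x \<in> A" using q_label[OF y(1), of x] q_self[OF x] by auto
  qed (use x in \<open>auto simp: B_def\<close>)
  have "\<exists>R. \<forall>x \<in> flags G. even (card {y \<in> flags G. p y = p x \<and> R y}) \<and>
    (odd (card {y \<in> flags G. q y = q x \<and> R y}) \<longleftrightarrow> q x \<in> B)"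
  proof (rule two_partition_parity[OF fin])
    show "B \<subseteq> q ` flags G" by (auto simp: B_def)
    fix S assume S: "S \<subseteq> flags G"
      and cl: "\<And>x y. x \<in> S \<Longrightarrow> y \<in> flags G \<Longrightarrow> p y = p x \<or> q y = q x \<Longrightarrow> y \<in> S"
    have inF: "x \<in> flags G" if "x \<in> S" for x using that S by blast
    have finS: "finite S" using finite_subset[OF S fin] .
    have cS: "corner_map G x \<in> S" if "x \<in> S" for x
      using cl[OF that, of "corner_map G x"] fl(5)[OF inF[OF that]]
        p[OF inF[OF that], of "corner_map G x"] by auto
    have qS: "y \<in> S" if "x \<in> S" "y \<in> flags G" "y \<in> q x" for x y
      using cl[OF that(1,2)] q[OF inF[OF that(1)] that(2)] that(3) by auto
    have sS: "side_map G x \<in> S" if "x \<in> S" for x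
      using qS[OF that, of "side_map G x"] fl(8,12)[OF inF[OF that]] by (auto simp: q_def)
    have aS: "arc_map G x \<in> S" if "x \<in> S" "label G x \<notin> A" for x
      using qS[OF that(1), of "arc_map G x"] fl(2,11)[OF inF[OF that(1)]] that(2) by (auto simp: q_def)
    let ?A = "{x \<in> S. label G x \<in> A}" and ?N = "{x \<in> S. label G x \<notin> A}"
    have "4 dvd card S"
      using ev S cS sS aS unfolding mixed_vertices_even_def by simp
    moreover have "4 dvd card ?N"
    proof -
      have "?N = (\<Union>e \<in> label G ` ?N. {y \<in> flags G. label G y = e})"
      proof (intro equalityI subsetI)
        fix y assume "y \<in> (\<Union>e \<in> label G ` ?N. {y \<in> flags G. label G y = e})"
        then obtain x where "x \<in> S" "label G x \<notin> A" "y \<in> flags G" "label G y = label G x" by auto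
        then show "y \<in> ?N" using qS[of x y] by (auto simp: q_def)
      qed (use inF in auto)
      then have "card ?N = card (\<Union>e \<in> label G ` ?N. {y \<in> flags G. label G y = e})" by simp
      also have "\<dots> = (\<Sum>e \<in> label G ` ?N. card {y \<in> flags G. label G y = e})"
        using finS fin by (intro card_UN_disjoint) auto
      also have "\<dots> = (\<Sum>e \<in> label G ` ?N. 4)" using fl(14)[OF inF] by (intro sum.cong) auto
      finally show ?thesis by simp
    qed
    moreover have "card S = card ?A + card ?N"
      using finS by (subst card_Un_disjoint[symmetric]) (auto intro: arg_cong[of _ _ card])
    ultimately have A4: "4 dvd card ?A" using dvd_add_left_iff[of 4 "card ?N" "card ?A"] by simp
    have "B \<inter> q ` S = q ` ?A" using qB[OF inF] by (auto simp: B_def)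
    moreover have "even (card (q ` ?A))"
    proof (rule even_card_image_of_pairs)
      show "finite ?A" using finS by simp
      show "4 dvd card ?A" by (rule A4)
      fix x assume x: "x \<in> ?A"
      then have "q y = q x \<longleftrightarrow> y \<in> {x, side_map G x}" if "y \<in> S" for y
        using q[OF inF[of x] inF[OF that]] by (simp add: q_def)
      then have "{y \<in> ?A. q y = q x} = {x, side_map G x}"
        using x sS[of x] fl(12)[OF inF[of x]] by auto
      moreover have "side_map G x \<noteq> x" using x fl(9)[OF inF[of x]] by simp
      ultimately show "card {y \<in> ?A. q y = q x} = 2" by (auto simp: card_insert_if)
    qed
    ultimately show "even (card (B \<inter> q ` S))" by simp
  qed
  then obtain R where R: "\<And>x. x \<in> flags G \<Longrightarrow> even (card {y \<in> flags G. p y = p x \<and> R y})"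
    "\<And>x. x \<in> flags G \<Longrightarrow> odd (card {y \<in> flags G. q y = q x \<and> R y}) \<longleftrightarrow> q x \<in> B"
    by blast
  have R': "R (corner_map G x) = R x" "label G x \<in> A \<Longrightarrow> R (side_map G x) \<noteq> R x"
    "label G x \<notin> A \<Longrightarrow> R (arc_map G (side_map G x)) \<noteq> R (arc_map G x) \<longleftrightarrow> R (side_map G x) \<noteq> R x"
    if x: "x \<in> flags G" for x
  proof -
    have "{y \<in> flags G. p y = p x \<and> R y} = {y \<in> {x, corner_map G x}. R y}"
      using p[OF x] x fl(5)[OF x] by auto
    then have "card {y \<in> flags G. p y = p x \<and> R y} = of_bool (R x) + of_bool (R (corner_map G x))"
      using fl(6)[OF x] by (simp only: card_filter_pair not_False_eq_True)
    then show "R (corner_map G x) = R x"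
      using R(1)[OF x] by (auto simp: of_bool_def split: if_splits)
    have qx: "{y \<in> flags G. q y = q x \<and> R y} = {y \<in> q x. R y}"
      using q[OF x] q_sub[OF x] by blast
    show "R (side_map G x) \<noteq> R x" if l: "label G x \<in> A"
    proof -
      have "{y \<in> flags G. q y = q x \<and> R y} = {y \<in> {x, side_map G x}. R y}"
        unfolding qx using l by (simp add: q_def)
      then have "card {y \<in> flags G. q y = q x \<and> R y} = of_bool (R x) + of_bool (R (side_map G x))"
        using fl(9)[OF x] by (simp only: card_filter_pair not_False_eq_True)
      then show ?thesis
        using R(2)[OF x] qB[OF x] l by (auto simp: of_bool_def split: if_splits)
    qed
    show "R (arc_map G (side_map G x)) \<noteq> R (arc_map G x) \<longleftrightarrow> R (side_map G x) \<noteq> R x" if l: "label G x \<notin> A"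
    proof -
      let ?s = "side_map G x"
      note ef = edge_flags[OF G x]
      have "{y \<in> flags G. q y = q x \<and> R y} = {y \<in> {x, arc_map G x}. R y} \<union> {y \<in> {?s, arc_map G ?s}. R y}"
        unfolding qx using l ef(1) by (auto simp: q_def)
      moreover have "card \<dots> = card {y \<in> {x, arc_map G x}. R y} + card {y \<in> {?s, arc_map G ?s}. R y}"
        using fl(9,13)[OF x] ef(2) by (intro card_Un_disjoint) auto
      moreover have "card {y \<in> {x, arc_map G x}. R y} = of_bool (R x) + of_bool (R (arc_map G x))"
        "card {y \<in> {?s, arc_map G ?s}. R y} = of_bool (R ?s) + of_bool (R (arc_map G ?s))"
        using fl(3)[OF x] fl(3)[OF fl(8)[OF x]] by (simp_all only: card_filter_pair not_False_eq_True)
      ultimately have "card {y \<in> flags G. q y = q x \<and> R y} =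
          (of_bool (R x) + of_bool (R (arc_map G x))) + (of_bool (R ?s) + of_bool (R (arc_map G ?s)))"
        by simp
      moreover have "even (card {y \<in> flags G. q y = q x \<and> R y})" using R(2)[OF x] qB[OF x] l by simp
      ultimately show ?thesis
        by (cases "R x"; cases "R (arc_map G x)"; cases "R ?s"; cases "R (arc_map G ?s)") simp_all
    qed
  qed
  have "R (side_map G (arc_map G x)) \<noteq> R (arc_map G x) \<longleftrightarrow> R (side_map G x) \<noteq> R x" if x: "x \<in> flags G" for x
  proof (cases "label G x \<in> A")
    case True
    then show ?thesis using R'(2)[OF x] R'(2)[OF fl(2)[OF x]] fl(11)[OF x] by simp
  next
    case False
    then show ?thesis using R'(3)[OF x] edge_flags(3)[OF G x] by simp
  qed
  then show ?thesis using R'(1,2) by (intro exI[of _ R]) blast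
qed

text \<open>
  Nothing changes around a vertex, so the constant colouring is the local solution there; the face
  solution \<open>R\<close> prescribes the same change along both sides of an edge, which yields the edge
  solution \<open>Q\<close>.
\<close>

lemma mixed_vertices_even_imp_bipartite:
  assumes G: "ribbon_graph G" and A: "A \<subseteq> edges G" and triv: "cocycles_trivial G"
    and ev: "mixed_vertices_even G A"
  shows "bipartite (edge_induced (underlying G) A)"
proof -
  note fl = ribbon_graph_flagD[OF G]
  obtain R where R0: "\<forall>x \<in> flags G. R (corner_map G x) = R x \<and>
      (label G x \<in> A \<longrightarrow> R (side_map G x) \<noteq> (R x :: bool)) \<and>
      (R (side_map G (arc_map G x)) \<noteq> R (arc_map G x) \<longleftrightarrow> R (side_map G x) \<noteq> R x)"
    using mixed_vertices_even_imp_colouring[OF G ev] ..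
  have R: "R (corner_map G x) = R x" "label G x \<in> A \<Longrightarrow> R (side_map G x) \<noteq> R x"
    "R (side_map G (arc_map G x)) \<noteq> R (arc_map G x) \<longleftrightarrow> R (side_map G x) \<noteq> R x"
    if "x \<in> flags G" for x
    using bspec[OF R0 that] by blast+
  define E where "E = label G ` {x \<in> flags G. R (side_map G x) \<noteq> R x}"
  have E: "label G x \<in> E \<longleftrightarrow> R (side_map G x) \<noteq> R x" if x: "x \<in> flags G" for x
  proof
    assume "label G x \<in> E"
    then obtain y where y: "y \<in> flags G" "R (side_map G y) \<noteq> R y" "label G x = label G y"
      by (auto simp: E_def)
    then have "x \<in> {y, arc_map G y, side_map G y, arc_map G (side_map G y)}"
      using x edge_flags(1)[OF G y(1)] by auto
    then show "R (side_map G x) \<noteq> R x"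
      using y(2) R(3)[OF y(1)] R(3)[OF fl(8)[OF y(1)]] fl(10)[OF y(1)]
      by (elim insertE emptyE) auto
  qed (use x in \<open>auto simp: E_def\<close>)
  obtain Q where "\<forall>x \<in> flags G. (Q (arc_map G x) \<noteq> (Q x :: bool) \<longleftrightarrow> label G x \<in> {}) \<and>
      (Q (side_map G x) \<noteq> Q x \<longleftrightarrow> label G x \<in> E)"
    using edge_colouring_exists[OF G, of "{}" E] ..
  note Q = bspec[OF this]
  have "\<exists>f. \<forall>x \<in> flags G. (f (arc_map G x) \<noteq> f x \<longleftrightarrow> False \<noteq> False) \<and>
      (f (side_map G x) \<noteq> f x \<longleftrightarrow> Q (side_map G x) \<noteq> Q x) \<and>
      (f (corner_map G x) \<noteq> (f x :: bool) \<longleftrightarrow> R (corner_map G x) \<noteq> R x)"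
    by (rule triv[unfolded cocycles_trivial_def, rule_format, of "\<lambda>_. False" Q R])
      (use Q E R(1) in simp)
  then obtain f where "\<forall>x \<in> flags G. (f (arc_map G x) \<noteq> f x \<longleftrightarrow> False \<noteq> False) \<and>
      (f (side_map G x) \<noteq> f x \<longleftrightarrow> Q (side_map G x) \<noteq> Q x) \<and>
      (f (corner_map G x) \<noteq> (f x :: bool) \<longleftrightarrow> R (corner_map G x) \<noteq> R x)" ..
  note f = bspec[OF this]
  show ?thesis
    unfolding bipartite_edge_induced_iff[OF G A]
  proof (intro exI[of _ f] ballI conjI impI)
    fix x assume x: "x \<in> flags G"
    show "f (corner_map G x) = f x" "f (arc_map G x) = f x" using f[OF x] R(1)[OF x] by auto
    show "f (side_map G x) \<noteq> f x" if "label G x \<in> A" using f[OF x] Q[OF x] E[OF x] R(2)[OF x that] by blast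
  qed
qed

lemma dual_simps:
  assumes "ribbon_graph G"
  shows "flags (dual G) = flags G" "edges (dual G) = edges G" "label (dual G) = label G"
    "corner_map (dual G) = corner_map G"
    "x \<in> flags G \<Longrightarrow> arc_map (dual G) x = side_map G x"
    "x \<in> flags G \<Longrightarrow> side_map (dual G) x = arc_map G x"
  using ribbon_graph_flagD(1)[OF assms] by (simp_all add: dual_def)

lemma cocycles_trivial_dual:
  assumes G: "ribbon_graph G" and triv: "cocycles_trivial G"
  shows "cocycles_trivial (dual G)"
  unfolding cocycles_trivial_def
proof (intro allI impI)
  fix P Q R :: "'a \<Rightarrow> bool"
  note d = dual_simps[OF G]
  assume "\<forall>x \<in> flags (dual G). (P (arc_map (dual G) x) \<noteq> P x \<longleftrightarrow> Q (arc_map (dual G) x) \<noteq> Q x) \<and>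
        (Q (side_map (dual G) x) \<noteq> Q x \<longleftrightarrow> R (side_map (dual G) x) \<noteq> R x) \<and>
        (P (corner_map (dual G) x) \<noteq> P x \<longleftrightarrow> R (corner_map (dual G) x) \<noteq> R x)"
  then have PQR: "\<And>x. x \<in> flags G \<Longrightarrow> (P (side_map G x) \<noteq> P x \<longleftrightarrow> Q (side_map G x) \<noteq> Q x) \<and>
        (Q (arc_map G x) \<noteq> Q x \<longleftrightarrow> R (arc_map G x) \<noteq> R x) \<and>
        (P (corner_map G x) \<noteq> P x \<longleftrightarrow> R (corner_map G x) \<noteq> R x)"
    by (simp add: d)
  have "\<exists>f. \<forall>x \<in> flags G. (f (arc_map G x) \<noteq> f x \<longleftrightarrow> R (arc_map G x) \<noteq> R x) \<and>
        (f (side_map G x) \<noteq> f x \<longleftrightarrow> Q (side_map G x) \<noteq> Q x) \<and>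
        (f (corner_map G x) \<noteq> (f x :: bool) \<longleftrightarrow> P (corner_map G x) \<noteq> P x)"
    by (rule triv[unfolded cocycles_trivial_def, rule_format, of R Q P]) (use PQR in blast)
  then obtain f where "\<forall>x \<in> flags G. (f (arc_map G x) \<noteq> f x \<longleftrightarrow> R (arc_map G x) \<noteq> R x) \<and>
        (f (side_map G x) \<noteq> f x \<longleftrightarrow> Q (side_map G x) \<noteq> Q x) \<and>
        (f (corner_map G x) \<noteq> (f x :: bool) \<longleftrightarrow> P (corner_map G x) \<noteq> P x)" ..
  note f = bspec[OF this]
  show "\<exists>f :: 'a \<Rightarrow> bool. \<forall>x \<in> flags (dual G). (f (arc_map (dual G) x) \<noteq> f x \<longleftrightarrow> P (arc_map (dual G) x) \<noteq> P x) \<and>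
        (f (side_map (dual G) x) \<noteq> f x \<longleftrightarrow> Q (side_map (dual G) x) \<noteq> Q x) \<and>
        (f (corner_map (dual G) x) \<noteq> f x \<longleftrightarrow> R (corner_map (dual G) x) \<noteq> R x)"
  proof (intro exI[of _ f] ballI)
    fix x assume "x \<in> flags (dual G)"
    then have x: "x \<in> flags G" by (simp add: d)
    show "(f (arc_map (dual G) x) \<noteq> f x \<longleftrightarrow> P (arc_map (dual G) x) \<noteq> P x) \<and>
        (f (side_map (dual G) x) \<noteq> f x \<longleftrightarrow> Q (side_map (dual G) x) \<noteq> Q x) \<and>
        (f (corner_map (dual G) x) \<noteq> f x \<longleftrightarrow> R (corner_map (dual G) x) \<noteq> R x)"
      unfolding d(4) d(5)[OF x] d(6)[OF x] using f[OF x] PQR[OF x] by blast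
  qed
qed

section \<open>Partial duals of plane graphs\<close>

lemma mconnected_partial_dual:
  assumes G: "plane_graph G" and A: "A \<subseteq> edges G" and H: "boundary_orientation G (edges G - A) H"
  shows "mconnected (underlying (partial_dual G A H))"
proof (cases "flags G = {}")
  case True
  have "topspace (triangle_space G) = {}" using True by (simp add: topspace_triangle_space)
  then have "p ` topspace (triangle_space G) = {}" for p :: "'a \<times> real \<times> real \<times> real \<Rightarrow> real ^ 3"
    by (simp only: image_empty)
  moreover have "axis 1 1 \<in> sphere (0 :: real ^ 3) 1" by (simp add: norm_axis_1)
  ultimately have "p ` topspace (triangle_space G) \<noteq> sphere (0 :: real ^ 3) 1"
    for p :: "'a \<times> real \<times> real \<times> real \<Rightarrow> real ^ 3"
    by blast
  then have "\<not> quotient_map (triangle_space G) (top_of_set (sphere (0 :: real ^ 3) 1)) p" for p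
    using quotient_imp_surjective_map by fastforce
  then have "card (bare G) = 1" using G unfolding plane_graph_def by blast
  then obtain d where "bare G = {d}" by (auto simp: card_1_singleton_iff)
  then have mv: "mverts (underlying (partial_dual G A H)) = {Inr d}"
    using True partial_dual_simps(1,2)[OF plane_graph_ribbon[OF G] A H]
    by (simp add: underlying_def vertices_def)
  then have "walk (underlying (partial_dual G A H)) (Inr d) [] (Inr d)" by simp
  then show ?thesis unfolding mconnected_def mv by blast
next
  case False
  let ?D = "partial_dual G A H"
  note R = plane_graph_ribbon[OF G]
  note pd = partial_dual_simps[OF R A H]
  show ?thesis
  proof (rule mconnected_underlying[OF ribbon_graph_partial_dual[OF R A H]])
    show "flags ?D \<noteq> {}" using False pd by simp
    show "bare ?D = {}" using G False pd by (simp add: plane_graph_def)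
    fix S assume S: "S \<subseteq> flags ?D" "S \<noteq> {}"
      and cl: "\<And>x. x \<in> S \<Longrightarrow> corner_map ?D x \<in> S \<and> arc_map ?D x \<in> S \<and> side_map ?D x \<in> S"
    have "S = flags G"
    proof (rule flags_connected[OF G _ S(2)])
      show "S \<subseteq> flags G" using S(1) pd by simp
      fix x assume x: "x \<in> S"
      then have "x \<in> flags G" using S(1) pd by auto
      then show "corner_map G x \<in> S \<and> arc_map G x \<in> S \<and> side_map G x \<in> S"
        using cl[OF x] pd(7,8,9) by (simp split: if_splits)
    qed
    then show "S = flags ?D" using pd by simp
  qed
qed

lemma bipartite_partial_dual_iff:
  assumes G: "plane_graph G" and A: "A \<subseteq> edges G" and H: "boundary_orientation G (edges G - A) H"
  shows "bipartite (underlying (partial_dual G A H)) \<longleftrightarrow>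
    even_at_vertices G A \<and> even_at_vertices (dual G) (edges G - A)"
proof -
  note R = plane_graph_ribbon[OF G]
  note RD = ribbon_graph_dual[OF R]
  note fl = ribbon_graph_flagD[OF R]
  note pd = partial_dual_simps[OF R A H]
  note d = dual_simps[OF R]
  have AD: "edges G - A \<subseteq> edges (dual G)" using d(2) by simp
  have iff: "(f (arc_map (partial_dual G A H) x) = f x \<and> f (side_map (partial_dual G A H) x) \<noteq> f x) \<longleftrightarrow>
      (f (arc_map G x) \<noteq> f x \<longleftrightarrow> label G x \<in> A) \<and> (f (side_map G x) \<noteq> f x \<longleftrightarrow> label G x \<notin> A)"
    if "x \<in> flags G" for f :: "'a \<Rightarrow> bool" and x
    unfolding pd(8)[OF that] pd(9)[OF that] by (cases "label G x \<in> A") auto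
  have "bipartite (underlying (partial_dual G A H)) \<longleftrightarrow>
      (\<exists>f. \<forall>x \<in> flags G. f (corner_map G x) = f x \<and>
        (f (arc_map G x) \<noteq> (f x :: bool) \<longleftrightarrow> label G x \<in> A) \<and> (f (side_map G x) \<noteq> f x \<longleftrightarrow> label G x \<notin> A))"
    (is "_ \<longleftrightarrow> (\<exists>f. ?P f)")
    unfolding bipartite_underlying_iff[OF ribbon_graph_partial_dual[OF R A H]] pd(1,7)
    using iff by (intro ex_cong1 ball_cong refl) simp
  also have "\<dots> \<longleftrightarrow> even_at_vertices G A \<and> even_at_vertices (dual G) (edges G - A)"
  proof
    assume "\<exists>f. ?P f"
    then obtain f where "?P f" ..
    note f = bspec[OF this]
    have "even_at_vertices G A"
      by (rule colouring_imp_even_at_vertices[OF R A, of f]) (use f in blast)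
    moreover have "even_at_vertices (dual G) (edges G - A)"
    proof (rule colouring_imp_even_at_vertices[OF RD AD, of f])
      fix x assume "x \<in> flags (dual G)"
      then have x: "x \<in> flags G" using d(1) by simp
      show "f (corner_map (dual G) x) = f x \<and>
          (f (arc_map (dual G) x) \<noteq> f x \<longleftrightarrow> label (dual G) x \<in> edges G - A)"
        unfolding d(3,4) d(5)[OF x] using f[OF x] fl(1)[OF x] by blast
    qed
    ultimately show "even_at_vertices G A \<and> even_at_vertices (dual G) (edges G - A)" by blast
  next
    assume ev: "even_at_vertices G A \<and> even_at_vertices (dual G) (edges G - A)"
    obtain P where "\<forall>x \<in> flags G. P (corner_map G x) = P x \<and> (P (arc_map G x) \<noteq> (P x :: bool) \<longleftrightarrow> label G x \<in> A)"
      using even_at_vertices_imp_colouring[OF R conjunct1[OF ev]] ..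
    note P = bspec[OF this]
    obtain T where "\<forall>x \<in> flags (dual G). T (corner_map (dual G) x) = T x \<and>
        (T (arc_map (dual G) x) \<noteq> (T x :: bool) \<longleftrightarrow> label (dual G) x \<in> edges G - A)"
      using even_at_vertices_imp_colouring[OF RD conjunct2[OF ev]] ..
    note T0 = bspec[OF this, unfolded d(1,3,4)]
    have T: "T (corner_map G x) = T x \<and> (T (side_map G x) \<noteq> T x \<longleftrightarrow> label G x \<notin> A)"
      if x: "x \<in> flags G" for x
      using T0[OF x] fl(1)[OF x] unfolding d(5)[OF x] by blast
    obtain Q where "\<forall>x \<in> flags G. (Q (arc_map G x) \<noteq> (Q x :: bool) \<longleftrightarrow> label G x \<in> A) \<and>
        (Q (side_map G x) \<noteq> Q x \<longleftrightarrow> label G x \<in> edges G - A)"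
      using edge_colouring_exists[OF R, of A "edges G - A"] ..
    note Q0 = bspec[OF this]
    have Q: "(Q (arc_map G x) \<noteq> Q x \<longleftrightarrow> label G x \<in> A) \<and> (Q (side_map G x) \<noteq> Q x \<longleftrightarrow> label G x \<notin> A)"
      if x: "x \<in> flags G" for x
      using Q0[OF x] fl(1)[OF x] by blast
    have "\<exists>f. \<forall>x \<in> flags G. (f (arc_map G x) \<noteq> f x \<longleftrightarrow> P (arc_map G x) \<noteq> P x) \<and>
        (f (side_map G x) \<noteq> f x \<longleftrightarrow> Q (side_map G x) \<noteq> Q x) \<and>
        (f (corner_map G x) \<noteq> (f x :: bool) \<longleftrightarrow> T (corner_map G x) \<noteq> T x)"
      by (rule plane_graph_cocycles_trivial[OF G, unfolded cocycles_trivial_def, rule_format, of P Q T])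
        (use P Q T in blast)
    then obtain f where "\<forall>x \<in> flags G. (f (arc_map G x) \<noteq> f x \<longleftrightarrow> P (arc_map G x) \<noteq> P x) \<and>
        (f (side_map G x) \<noteq> f x \<longleftrightarrow> Q (side_map G x) \<noteq> Q x) \<and>
        (f (corner_map G x) \<noteq> (f x :: bool) \<longleftrightarrow> T (corner_map G x) \<noteq> T x)" ..
    note f = bspec[OF this]
    have "?P f" using f P Q T by blast
    then show "\<exists>f. ?P f" by (intro exI[of _ f])
  qed
  finally show ?thesis .
qed

lemma mixed_vertices_even_iff:
  assumes G: "ribbon_graph G" and A: "A \<subseteq> edges G" and H: "boundary_orientation G (edges G - A) H"
  shows "even_at_vertices (partial_dual G A H) (edges (partial_dual G A H)) \<longleftrightarrow> mixed_vertices_even G A"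
proof -
  note pd = partial_dual_simps[OF G A H]
  have un: "vertex_union (partial_dual G A H) S \<longleftrightarrow> S \<subseteq> flags G \<and>
      (\<forall>x \<in> S. corner_map G x \<in> S \<and> (if label G x \<in> A then side_map G x else arc_map G x) \<in> S)" for S
    unfolding vertex_union_def pd(1,7) using pd(8) by (intro conj_cong ball_cong refl) auto
  have "{x \<in> S. label G x \<in> edges G} = S" if "S \<subseteq> flags G" for S
    using that ribbon_graph_flagD(1)[OF G] by auto
  then show ?thesis
    unfolding even_at_vertices_def mixed_vertices_even_def un pd(3,6) by auto
qed

lemma mixed_vertices_even_dual:
  assumes G: "ribbon_graph G" and ev: "mixed_vertices_even G A"
  shows "mixed_vertices_even (dual G) (edges G - A)"
  unfolding mixed_vertices_even_def
proof (intro allI impI)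
  note d = dual_simps[OF G]
  fix S assume "S \<subseteq> flags (dual G)" and
    cl: "\<forall>x \<in> S. corner_map (dual G) x \<in> S \<and>
      (if label (dual G) x \<in> edges G - A then side_map (dual G) x else arc_map (dual G) x) \<in> S"
  then have S: "S \<subseteq> flags G" using d(1) by simp
  have "corner_map G x \<in> S \<and> (if label G x \<in> A then side_map G x else arc_map G x) \<in> S" if x: "x \<in> S" for x
  proof -
    have xF: "x \<in> flags G" using x S by blast
    show ?thesis
      using bspec[OF cl x] ribbon_graph_flagD(1)[OF G xF] unfolding d(3,4) d(5)[OF xF] d(6)[OF xF]
      by (simp split: if_splits)
  qed
  then show "4 dvd card S" using ev S unfolding mixed_vertices_even_def by simp
qed

lemma eulerian_partial_dual_iff:
  assumes G: "plane_graph G" and A: "A \<subseteq> edges G" and H: "boundary_orientation G (edges G - A) H"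
  shows "eulerian (underlying (partial_dual G A H)) \<longleftrightarrow>
    bipartite (edge_induced (underlying G) A) \<and>
    bipartite (edge_induced (underlying (dual G)) (edges G - A))"
proof -
  note R = plane_graph_ribbon[OF G]
  note RD = ribbon_graph_dual[OF R]
  note RP = ribbon_graph_partial_dual[OF R A H]
  note fl = ribbon_graph_flagD[OF R]
  note pd = partial_dual_simps[OF R A H]
  note d = dual_simps[OF R]
  have AD: "edges G - A \<subseteq> edges (dual G)" using d(2) by simp
  have "eulerian (underlying (partial_dual G A H)) \<longleftrightarrow> mixed_vertices_even G A"
    using eulerian_iff_even_at_vertices[OF RP] mconnected_partial_dual[OF G A H]
      mixed_vertices_even_iff[OF R A H] by simp
  also have "\<dots> \<longleftrightarrow> bipartite (edge_induced (underlying G) A) \<and>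
    bipartite (edge_induced (underlying (dual G)) (edges G - A))"
  proof
    assume ev: "mixed_vertices_even G A"
    note triv = plane_graph_cocycles_trivial[OF G]
    show "bipartite (edge_induced (underlying G) A) \<and>
        bipartite (edge_induced (underlying (dual G)) (edges G - A))"
      using mixed_vertices_even_imp_bipartite[OF R A triv ev]
        mixed_vertices_even_imp_bipartite[OF RD AD cocycles_trivial_dual[OF R triv] mixed_vertices_even_dual[OF R ev]]
      by blast
  next
    assume bip: "bipartite (edge_induced (underlying G) A) \<and>
        bipartite (edge_induced (underlying (dual G)) (edges G - A))"
    obtain g where "\<forall>x \<in> flags G. g (corner_map G x) = g x \<and> g (arc_map G x) = g x \<and>
        (label G x \<in> A \<longrightarrow> g (side_map G x) \<noteq> (g x :: bool))"
      using conjunct1[OF bip] unfolding bipartite_edge_induced_iff[OF R A] ..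
    note g = bspec[OF this]
    obtain h where "\<forall>x \<in> flags (dual G). h (corner_map (dual G) x) = h x \<and> h (arc_map (dual G) x) = h x \<and>
        (label (dual G) x \<in> edges G - A \<longrightarrow> h (side_map (dual G) x) \<noteq> (h x :: bool))"
      using conjunct2[OF bip] unfolding bipartite_edge_induced_iff[OF RD AD] ..
    note h0 = bspec[OF this, unfolded d(1,3,4)]
    have h: "h (corner_map G x) = h x \<and> h (side_map G x) = h x \<and> (label G x \<notin> A \<longrightarrow> h (arc_map G x) \<noteq> h x)"
      if x: "x \<in> flags G" for x
      using h0[OF x] fl(1)[OF x] unfolding d(5)[OF x] d(6)[OF x] by blast
    have "even_at_vertices (partial_dual G A H) (edges (partial_dual G A H))"
    proof (rule colouring_imp_even_at_vertices[OF RP order_refl, of "\<lambda>x. g x \<noteq> h x"])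
      fix x assume "x \<in> flags (partial_dual G A H)"
      then have x: "x \<in> flags G" using pd(1) by simp
      show "((g (corner_map (partial_dual G A H) x) \<noteq> h (corner_map (partial_dual G A H) x)) = (g x \<noteq> h x)) \<and>
          (((g (arc_map (partial_dual G A H) x) \<noteq> h (arc_map (partial_dual G A H) x)) \<noteq> (g x \<noteq> h x)) \<longleftrightarrow>
            label (partial_dual G A H) x \<in> edges (partial_dual G A H))"
        unfolding pd(3,6,7) pd(8)[OF x] using g[OF x] h[OF x] fl(1)[OF x]
        by (cases "label G x \<in> A") auto
    qed
    then show "mixed_vertices_even G A" unfolding mixed_vertices_even_iff[OF R A H] .
  qed
  finally show ?thesis .
qed

theorem theorem2:
  fixes G :: "('f, 'e, 'd) arrow_ribbon" and A :: "'e set" and H :: "'f set"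
  assumes "plane_graph G"
    and "A \<subseteq> edges G"
    and "boundary_orientation G (edges G - A) H"
  shows "(bipartite (underlying (partial_dual G A H)) \<longleftrightarrow>
            (\<forall>K \<in> mcomponents (edge_induced (underlying G) A). eulerian K) \<and>
            (\<forall>K \<in> mcomponents (edge_induced (underlying (dual G)) (edges G - A)). eulerian K)) \<and>
         (eulerian (underlying (partial_dual G A H)) \<longleftrightarrow>
            bipartite (edge_induced (underlying G) A) \<and>
            bipartite (edge_induced (underlying (dual G)) (edges G - A)))"
proof -
  note R = plane_graph_ribbon[OF assms(1)]
  have "edges G - A \<subseteq> edges (dual G)" using dual_simps(2)[OF R] by simp
  then show ?thesis
    using bipartite_partial_dual_iff[OF assms] eulerian_partial_dual_iff[OF assms]
      components_eulerian_iff_even_at_vertices[OF R assms(2)]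
      components_eulerian_iff_even_at_vertices[OF ribbon_graph_dual[OF R]] by simp
qed

end
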